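(* Let $Q$ be a valued quiver (with any orientation) of type $\tilde G_{21}$, $\tilde G_{22}$, $\tilde F_{41}$, $\tilde F_{42}$, $\tilde A_{11}$ or $\tilde A_{12}$. Then the frieze sequences associated with the vertices of $Q$ satisfy linear recurrence relations.
   Context: Valued quivers: a (finite, acyclic) valued quiver $Q$ here is a finite graph without multiple edges on vertices $1,\dots,N$, with an orientation of its edges without oriented cycles, together with, for every edge between $i$ and $k$, a pair of positive integers $(a_{ik},a_{ki})$ (the valuation; edges with $a_{ik}=a_{ki}=1$ are called trivially valued). Frieze sequences: let $\mathcal F=\mathbb Q(x_1,\dots,x_N)$. The frieze sequences $(X^i_j)_{j\in\mathbb N}$ are defined by $X^i_0=x_i$ and $$X^i_{j+1}X^i_j=1+\prod_{s\to i}(X^s_{j+1})^{a_{is}}\prod_{i\to d}(X^d_j)^{a_{id}},$$ where $s\to i$ and $i\to d$ run over the oriented edges ending, respectively starting, at $i$; this determines all $X^i_j$ because there are no oriented cycles. Types (Dlab–Ringel notation): - $\tilde A_{11}$: two vertices joined by one edge with valuation $(1,4)$ (i.e. $\{a_{12},a_{21}\}=\{1,4\}$); $\tilde A_{12}$: two vertices joined by one edge with $a_{12}=a_{21}=2$. - $\tilde G_{21},\tilde G_{22}$: a chain $1-2-3$ with edge $1-2$ trivially valued and edge $2-3$ with $(a_{23},a_{32})=(1,3)$, respectively $(3,1)$ (the result covers both, so it does not depend on which is called which). - $\tilde F_{41},\tilde F_{42}$: a chain $1-2-3-4-5$ with all edges trivially valued except $3-4$, which has $(a_{34},a_{43})=(1,2)$,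 respectively $(2,1)$ (again both are covered). A sequence $(a_j)_{j\in\mathbb N}$ in $\mathcal F$ satisfies a linear recurrence if there are $s\ge1$ and $\alpha_0,\dots,\alpha_{s-1}\in\mathcal F$ with $a_{j+s}=\alpha_0a_j+\dots+\alpha_{s-1}a_{j+s-1}$ for all $j\in\mathbb N$. *)

theory Defs
  imports
    Complex_Main
    "HOL-Library.Poly_Mapping"
    "HOL-Computational_Algebra.Fraction_Field"
begin

section \<open>Rational functions\<close>

text \<open>
  A monomial is a finitely supported exponent vector, so \<open>(nat \<Rightarrow>\<^sub>0 nat) \<Rightarrow>\<^sub>0 rat\<close> is the polynomial
  ring over the rationals in the variables \<open>x\<^sub>0, x\<^sub>1, \<dots>\<close>.  The field \<open>\<rat>(x\<^sub>1, \<dots>, x\<^sub>N)\<close> is the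
  subfield \<open>rat_funs N\<close> of its field of fractions.
\<close>

type_synonym rat_mpoly = "(nat \<Rightarrow>\<^sub>0 nat) \<Rightarrow>\<^sub>0 rat"
type_synonym rat_fun = "rat_mpoly fract"

definition vars :: "rat_mpoly \<Rightarrow> nat set" where
  "vars p = (\<Union>m\<in>Poly_Mapping.keys p. Poly_Mapping.keys m)"

definition rat_funs :: "nat \<Rightarrow> rat_fun set" where
  "rat_funs N = {Fract p q |p q. q \<noteq> 0 \<and> vars p \<subseteq> {1..N} \<and> vars q \<subseteq> {1..N}}"

definition indet :: "nat \<Rightarrow> rat_fun" where
  "indet i = Fract (Poly_Mapping.single (Poly_Mapping.single i 1) 1) 1"


section \<open>Valued quivers\<close>

text \<open>
  The vertices are \<open>1, \<dots>, nverts Q\<close>, a pair \<open>(i, k) \<in> arrows Q\<close> is an oriented edge \<open>i \<rightarrow> k\<close>, and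
  \<open>val Q i k\<close> is \<open>a\<^sub>i\<^sub>k\<close>; it is meaningful only if \<open>i\<close> and \<open>k\<close> are joined by an edge.
\<close>

record vquiver =
  nverts :: nat
  arrows :: "(nat \<times> nat) set"
  val :: "nat \<Rightarrow> nat \<Rightarrow> nat"

text \<open>Acyclicity also rules out loops and multiple edges (a pair of opposite arrows).\<close>

definition valued_quiver :: "vquiver \<Rightarrow> bool" where
  "valued_quiver Q \<longleftrightarrow>
     arrows Q \<subseteq> {1..nverts Q} \<times> {1..nverts Q} \<and> acyclic (arrows Q) \<and>
     (\<forall>(i, k)\<in>arrows Q. val Q i k > 0 \<and> val Q k i > 0)"


section \<open>Types\<close>

text \<open>
  A valued graph on \<open>{1..n}\<close> is given by \<open>n\<close> together with a set of tuples \<open>(i, k, a\<^sub>i\<^sub>k, a\<^sub>k\<^sub>i)\<close>, one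
  for each edge.
\<close>

type_synonym vgraph = "nat \<times> (nat \<times> nat \<times> nat \<times> nat) set"

definition A11 :: vgraph where "A11 = (2, {(1, 2, 1, 4)})"
definition A12 :: vgraph where "A12 = (2, {(1, 2, 2, 2)})"
definition G21 :: vgraph where "G21 = (3, {(1, 2, 1, 1), (2, 3, 1, 3)})"
definition G22 :: vgraph where "G22 = (3, {(1, 2, 1, 1), (2, 3, 3, 1)})"
definition F41 :: vgraph where
  "F41 = (5, {(1, 2, 1, 1), (2, 3, 1, 1), (3, 4, 1, 2), (4, 5, 1, 1)})"
definition F42 :: vgraph where
  "F42 = (5, {(1, 2, 1, 1), (2, 3, 1, 1), (3, 4, 2, 1), (4, 5, 1, 1)})"

definition sym_edges :: "(nat \<times> nat \<times> nat \<times> nat) set \<Rightarrow> (nat \<times> nat \<times> nat \<times> nat) set" where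
  "sym_edges D = D \<union> (\<lambda>(i, k, a, b). (k, i, b, a)) ` D"

definition edges :: "vquiver \<Rightarrow> (nat \<times> nat \<times> nat \<times> nat) set" where
  "edges Q = (\<lambda>(i, k). (i, k, val Q i k, val Q k i)) ` arrows Q"

text \<open>
  \<open>Q\<close> is of type \<open>T\<close> if its underlying unoriented valued graph is isomorphic to \<open>T\<close>; the orientation
  and the numbering of the vertices are arbitrary.
\<close>

definition has_type :: "vquiver \<Rightarrow> vgraph \<Rightarrow> bool" where
  "has_type Q T \<longleftrightarrow>
     (\<exists>\<sigma>. bij_betw \<sigma> {1..fst T} {1..nverts Q} \<and>
       sym_edges (edges Q) = (\<lambda>(i, k, a, b). (\<sigma> i, \<sigma> k, a, b)) ` sym_edges (snd T))"


section \<open>Frieze sequences\<close>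

text \<open>\<open>X i j\<close> is \<open>X\<^sup>i\<^sub>j\<close>; only the values at vertices \<open>i\<close> of \<open>Q\<close> matter.\<close>

definition frieze_sequences :: "vquiver \<Rightarrow> (nat \<Rightarrow> nat \<Rightarrow> rat_fun) \<Rightarrow> bool" where
  "frieze_sequences Q X \<longleftrightarrow>
     (\<forall>i\<in>{1..nverts Q}.
       X i 0 = indet i \<and>
       (\<forall>j. X i (Suc j) * X i j =
          1 + (\<Prod>s | (s, i) \<in> arrows Q. X s (Suc j) ^ val Q i s) *
              (\<Prod>d | (i, d) \<in> arrows Q. X d j ^ val Q i d)))"

definition satisfies_linear_recurrence :: "'a::comm_ring_1 set \<Rightarrow> (nat \<Rightarrow> 'a) \<Rightarrow> bool" where
  "satisfies_linear_recurrence F a \<longleftrightarrow>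
     (\<exists>s\<ge>1. \<exists>\<alpha>. (\<forall>k<s. \<alpha> k \<in> F) \<and> (\<forall>j. a (j + s) = (\<Sum>k<s. \<alpha> k * a (j + k))))"


section \<open>Existence and uniqueness of the frieze sequences\<close>

text \<open>
  The defining equations can be solved for \<open>X\<^sup>i\<^sub>j\<^sub>+\<^sub>1\<close> because all terms are subtraction-free, hence
  nonzero, and because the quiver is acyclic.
\<close>

definition nonneg_poly :: "nat \<Rightarrow> rat_mpoly \<Rightarrow> bool" where
  "nonneg_poly N p \<longleftrightarrow> p \<noteq> 0 \<and> vars p \<subseteq> {1..N} \<and> (\<forall>m. Poly_Mapping.lookup p m \<ge> 0)"

definition subtraction_free :: "nat \<Rightarrow> rat_fun \<Rightarrow> bool" where
  "subtraction_free N f \<longleftrightarrow> (\<exists>p q. f = Fract p q \<and> nonneg_poly N p \<and> nonneg_poly N q)"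

lemma vars_add: "vars (p + q) \<subseteq> vars p \<union> vars q"
  using keys_add[of p q] unfolding vars_def by blast

lemma vars_mult: "vars (p * q) \<subseteq> vars p \<union> vars q"
proof
  fix v assume "v \<in> vars (p * q)"
  then obtain m where "m \<in> Poly_Mapping.keys (p * q)" "v \<in> Poly_Mapping.keys m"
    by (auto simp: vars_def)
  moreover from this(1) obtain a b where "m = a + b" "a \<in> Poly_Mapping.keys p" "b \<in> Poly_Mapping.keys q"
    using keys_mult[of p q] by blast
  ultimately show "v \<in> vars p \<union> vars q"
    using keys_add[of a b] unfolding vars_def by blast
qed

lemma nonneg_poly_one: "nonneg_poly N 1"
  by (auto simp: nonneg_poly_def vars_def lookup_one when_def)

lemma nonneg_poly_add:
  assumes "nonneg_poly N p" "nonneg_poly N q"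
  shows "nonneg_poly N (p + q)"
proof -
  obtain m where "Poly_Mapping.lookup p m \<noteq> 0"
    using assms(1) unfolding nonneg_poly_def by (metis lookup_zero poly_mapping_eqI)
  then have "Poly_Mapping.lookup (p + q) m \<noteq> 0"
    using assms unfolding nonneg_poly_def lookup_add
    by (metis add_nonneg_eq_0_iff)
  then have "p + q \<noteq> 0"
    by auto
  then show ?thesis
    using assms vars_add[of p q] by (auto simp: nonneg_poly_def lookup_add)
qed

lemma nonneg_poly_mult:
  assumes "nonneg_poly N p" "nonneg_poly N q"
  shows "nonneg_poly N (p * q)"
proof -
  have "Poly_Mapping.lookup (p * q) m \<ge> 0" for m
    using assms
    by (auto simp: nonneg_poly_def times_poly_mapping.rep_eq prod_fun_def Sum_any.expand_set when_def
             intro!: sum_nonneg mult_nonneg_nonneg)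
  then show ?thesis
    using assms vars_mult[of p q] by (auto simp: nonneg_poly_def)
qed

lemma subtraction_free_indet:
  assumes "i \<in> {1..N}"
  shows "subtraction_free N (indet i)"
proof -
  let ?p = "Poly_Mapping.single (Poly_Mapping.single i 1) 1 :: rat_mpoly"
  have "Poly_Mapping.lookup ?p (Poly_Mapping.single i 1) \<noteq> 0"
    by simp
  then have "?p \<noteq> 0"
    by (metis lookup_zero)
  then have "nonneg_poly N ?p"
    using assms by (auto simp: nonneg_poly_def vars_def lookup_single when_def split: if_splits)
  then show ?thesis
    using nonneg_poly_one unfolding subtraction_free_def indet_def by blast
qed

lemma subtraction_free_one: "subtraction_free N 1"
  unfolding subtraction_free_def One_fract_def using nonneg_poly_one by blast

lemma subtraction_free_add:
  assumes "subtraction_free N f" "subtraction_free N g"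
  shows "subtraction_free N (f + g)"
proof -
  obtain p q p' q' where *: "f = Fract p q" "g = Fract p' q'"
    "nonneg_poly N p" "nonneg_poly N q" "nonneg_poly N p'" "nonneg_poly N q'"
    using assms by (auto simp: subtraction_free_def)
  then have "f + g = Fract (p * q' + p' * q) (q * q')"
    by (simp add: nonneg_poly_def)
  with * show ?thesis
    unfolding subtraction_free_def by (blast intro: nonneg_poly_add nonneg_poly_mult)
qed

lemma subtraction_free_mult:
  assumes "subtraction_free N f" "subtraction_free N g"
  shows "subtraction_free N (f * g)"
proof -
  obtain p q p' q' where *: "f = Fract p q" "g = Fract p' q'"
    "nonneg_poly N p" "nonneg_poly N q" "nonneg_poly N p'" "nonneg_poly N q'"
    using assms by (auto simp: subtraction_free_def)
  then have "f * g = Fract (p * p') (q * q')"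
    by simp
  with * show ?thesis
    unfolding subtraction_free_def by (blast intro: nonneg_poly_mult)
qed

lemma subtraction_free_divide:
  assumes "subtraction_free N f" "subtraction_free N g"
  shows "subtraction_free N (f / g)"
proof -
  obtain p q p' q' where *: "f = Fract p q" "g = Fract p' q'"
    "nonneg_poly N p" "nonneg_poly N q" "nonneg_poly N p'" "nonneg_poly N q'"
    using assms by (auto simp: subtraction_free_def)
  then have "f / g = Fract (p * q') (q * p')"
    by simp
  with * show ?thesis
    unfolding subtraction_free_def by (blast intro: nonneg_poly_mult)
qed

lemma subtraction_free_power: "subtraction_free N f \<Longrightarrow> subtraction_free N (f ^ n)"
  by (induction n) (auto intro: subtraction_free_one subtraction_free_mult)

lemma subtraction_free_prod:
  "(\<And>i. i \<in> A \<Longrightarrow> subtraction_free N (f i)) \<Longrightarrow> subtraction_free N (prod f A)"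
  by (induction A rule: infinite_finite_induct)
    (auto intro: subtraction_free_one subtraction_free_mult)

lemma subtraction_free_nonzero: "subtraction_free N f \<Longrightarrow> f \<noteq> 0"
  by (auto simp: subtraction_free_def nonneg_poly_def Zero_fract_def eq_fract)

lemma subtraction_free_rat_funs: "subtraction_free N f \<Longrightarrow> f \<in> rat_funs N"
  by (auto simp: subtraction_free_def nonneg_poly_def rat_funs_def)

lemma finite_ancestors: "valued_quiver Q \<Longrightarrow> finite {k. (k, i) \<in> (arrows Q)\<^sup>+}"
  unfolding valued_quiver_def
  by (rule finite_subset[of _ "{1..nverts Q}"]) (auto dest: trancl_subset_Sigma[THEN subsetD])

lemma card_ancestors_less:
  assumes "valued_quiver Q" "(s, i) \<in> arrows Q"
  shows "card {k. (k, s) \<in> (arrows Q)\<^sup>+} < card {k. (k, i) \<in> (arrows Q)\<^sup>+}"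
proof (rule psubset_card_mono[OF finite_ancestors[OF assms(1)]])
  have "(s, s) \<notin> (arrows Q)\<^sup>+"
    using assms by (auto simp: valued_quiver_def acyclic_def)
  then show "{k. (k, s) \<in> (arrows Q)\<^sup>+} \<subset> {k. (k, i) \<in> (arrows Q)\<^sup>+}"
    using assms(2) by (auto intro: trancl_into_trancl)
qed

context
  notes prod.cong[fundef_cong]
begin

function frieze :: "vquiver \<Rightarrow> nat \<Rightarrow> nat \<Rightarrow> rat_fun" where
  "frieze Q i 0 = indet i"
| "frieze Q i (Suc j) =
     (if valued_quiver Q then
        (1 + (\<Prod>s | (s, i) \<in> arrows Q. frieze Q s (Suc j) ^ val Q i s) *
             (\<Prod>d | (i, d) \<in> arrows Q. frieze Q d j ^ val Q i d)) / frieze Q i j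
      else 0)"
  by pat_completeness auto
termination
  by (relation "measures [\<lambda>(Q, i, j). j, \<lambda>(Q, i, j). card {k. (k, i) \<in> (arrows Q)\<^sup>+}]")
    (auto intro: card_ancestors_less)

end

declare frieze.simps [simp del]

lemma subtraction_free_frieze:
  assumes "valued_quiver Q" "i \<in> {1..nverts Q}"
  shows "subtraction_free (nverts Q) (frieze Q i j)"
  using assms
proof (induction Q i j rule: frieze.induct)
  case (1 Q i)
  then show ?case
    by (simp add: frieze.simps(1) subtraction_free_indet)
next
  case (2 Q i j)
  have "s \<in> {1..nverts Q}" "d \<in> {1..nverts Q}" if "(s, d) \<in> arrows Q" for s d
    using that 2(4) by (auto simp: valued_quiver_def)
  then show ?case
    unfolding frieze.simps(2)[of Q i j] using 2
    by (auto intro!: subtraction_free_divide subtraction_free_add subtraction_free_mult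
        subtraction_free_prod subtraction_free_power subtraction_free_one)
qed

lemma frieze_sequences_frieze:
  assumes "valued_quiver Q"
  shows "frieze_sequences Q (frieze Q)"
  unfolding frieze_sequences_def
proof (intro ballI conjI allI)
  fix i j assume "i \<in> {1..nverts Q}"
  then have "frieze Q i j \<noteq> 0"
    using subtraction_free_nonzero subtraction_free_frieze[OF assms] by blast
  then show "frieze Q i (Suc j) * frieze Q i j =
      1 + (\<Prod>s | (s, i) \<in> arrows Q. frieze Q s (Suc j) ^ val Q i s) *
          (\<Prod>d | (i, d) \<in> arrows Q. frieze Q d j ^ val Q i d)"
    using assms by (simp add: frieze.simps(2)[of Q i j])
qed (simp add: frieze.simps(1))

lemma frieze_sequences_unique:
  assumes "valued_quiver Q" "frieze_sequences Q X" "i \<in> {1..nverts Q}"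
  shows "X i j = frieze Q i j"
  using assms
proof (induction Q i j rule: frieze.induct)
  case (1 Q i)
  then show ?case
    by (simp add: frieze.simps(1) frieze_sequences_def)
next
  case (2 Q i j)
  have verts: "s \<in> {1..nverts Q}" "d \<in> {1..nverts Q}" if "(s, d) \<in> arrows Q" for s d
    using that 2(4) by (auto simp: valued_quiver_def)
  have nz: "frieze Q i j \<noteq> 0"
    using subtraction_free_nonzero subtraction_free_frieze 2(4,6) by blast
  have "(\<Prod>s | (s, i) \<in> arrows Q. X s (Suc j) ^ val Q i s) =
        (\<Prod>s | (s, i) \<in> arrows Q. frieze Q s (Suc j) ^ val Q i s)"
    using 2(1)[OF 2(4) _ 2(4,5)] verts by (intro prod.cong) auto
  moreover have "(\<Prod>d | (i, d) \<in> arrows Q. X d j ^ val Q i d) =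
        (\<Prod>d | (i, d) \<in> arrows Q. frieze Q d j ^ val Q i d)"
    using 2(2)[OF 2(4) _ 2(4,5)] verts by (intro prod.cong) auto
  moreover have "X i j = frieze Q i j"
    using 2 by blast
  moreover have "X i (Suc j) * X i j =
      1 + (\<Prod>s | (s, i) \<in> arrows Q. X s (Suc j) ^ val Q i s) *
          (\<Prod>d | (i, d) \<in> arrows Q. X d j ^ val Q i d)"
    using 2(5,6) unfolding frieze_sequences_def by blast
  moreover have "frieze Q i (Suc j) * frieze Q i j =
      1 + (\<Prod>s | (s, i) \<in> arrows Q. frieze Q s (Suc j) ^ val Q i s) *
          (\<Prod>d | (i, d) \<in> arrows Q. frieze Q d j ^ val Q i d)"
    using frieze_sequences_frieze[OF 2(4)] 2(6) unfolding frieze_sequences_def by blast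
  ultimately have "X i (Suc j) * frieze Q i j = frieze Q i (Suc j) * frieze Q i j"
    by (simp only:)
  with nz show ?case
    by simp
qed

lemma frieze_sequences_cong:
  assumes "valued_quiver Q" "\<And>i. i \<in> {1..nverts Q} \<Longrightarrow> X i = Y i"
  shows "frieze_sequences Q X \<longleftrightarrow> frieze_sequences Q Y"
proof -
  have verts: "s \<in> {1..nverts Q}" "d \<in> {1..nverts Q}" if "(s, d) \<in> arrows Q" for s d
    using that assms(1) by (auto simp: valued_quiver_def)
  have "(\<Prod>s | (s, i) \<in> arrows Q. X s (Suc j) ^ val Q i s) =
        (\<Prod>s | (s, i) \<in> arrows Q. Y s (Suc j) ^ val Q i s)" for i j
    by (rule prod.cong) (use assms(2) verts in auto)
  moreover have "(\<Prod>d | (i, d) \<in> arrows Q. X d j ^ val Q i d) =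
        (\<Prod>d | (i, d) \<in> arrows Q. Y d j ^ val Q i d)" for i j
    by (rule prod.cong) (use assms(2) verts in auto)
  ultimately show ?thesis
    unfolding frieze_sequences_def using assms(2) by (intro ball_cong refl) simp
qed

lemma frieze_sequences_iff:
  assumes "valued_quiver Q"
  shows "frieze_sequences Q X \<longleftrightarrow> (\<forall>i\<in>{1..nverts Q}. X i = frieze Q i)"
proof
  assume "frieze_sequences Q X"
  then show "\<forall>i\<in>{1..nverts Q}. X i = frieze Q i"
    using frieze_sequences_unique[OF assms] by blast
next
  assume "\<forall>i\<in>{1..nverts Q}. X i = frieze Q i"
  then have "frieze_sequences Q X \<longleftrightarrow> frieze_sequences Q (frieze Q)"
    by (intro frieze_sequences_cong[OF assms]) blast
  then show "frieze_sequences Q X"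
    using frieze_sequences_frieze[OF assms] by blast
qed

lemma frieze_in_rat_funs:
  "valued_quiver Q \<Longrightarrow> i \<in> {1..nverts Q} \<Longrightarrow> frieze Q i j \<in> rat_funs (nverts Q)"
  by (intro subtraction_free_rat_funs subtraction_free_frieze)

end

theory Submission
  imports Defs
begin

text \<open>
  Up to delays, all arrows point away from one end of the chain.  If \<open>u\<close> is the sequence of a
  leaf, then cancelling in the frieze relations expresses the sequences along the trivially valued
  arm starting there as continuants in \<open>u\<close>.  For the leaves there are relations of the form
  \<open>v\<^sub>j\<^sub>+\<^sub>m + v\<^sub>j\<^sub>-\<^sub>m = J\<^sub>j u\<^sub>j\<close> with a periodic sequence \<open>J\<close> (the cluster variables of the quasi-simple
  representations in an exceptional tube).  That \<open>J\<close> is periodic follows by writing \<open>J\<^sub>j\<close> as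
  an expression in a neighbouring seed that is invariant under reversal of time.  A linear system
  with periodic coefficients yields recurrences with constant coefficients, and the remaining
  sequences are polynomials in the leaf sequences and in periodic sequences.
\<close>

section \<open>Linear recurrences over a subfield\<close>

text \<open>
  A sequence satisfies a linear recurrence over \<open>F\<close> iff it lies in a finitely generated space of
  sequences that is closed under the shift.
\<close>

definition lspan :: "'a::field set \<Rightarrow> 'i set \<Rightarrow> ('i \<Rightarrow> nat \<Rightarrow> 'a) \<Rightarrow> (nat \<Rightarrow> 'a) set" where
  "lspan F I b = {f. \<exists>M. (\<forall>k\<in>I. M k \<in> F) \<and> (\<forall>j. f j = (\<Sum>k\<in>I. M k * b k j))}"

definition shift_closed :: "'a::field set \<Rightarrow> 'i set \<Rightarrow> ('i \<Rightarrow> nat \<Rightarrow> 'a) \<Rightarrow> bool" where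
  "shift_closed F I b \<longleftrightarrow> finite I \<and> (\<forall>i\<in>I. (\<lambda>j. b i (Suc j)) \<in> lspan F I b)"

text \<open>Only coefficients are confined to \<open>F\<close>; sequences may take values anywhere
  in the ambient field. Values must lie in \<open>F\<close> where they enter coefficients, as in the
  quotients \<open>K\<close>, \<open>A\<close> and \<open>J\<close> below.\<close>

locale subfield =
  fixes F :: "'a::field set"
  assumes zero_closed: "0 \<in> F"
    and one_closed: "1 \<in> F"
    and diff_closed: "x \<in> F \<Longrightarrow> y \<in> F \<Longrightarrow> x - y \<in> F"
    and mult_closed: "x \<in> F \<Longrightarrow> y \<in> F \<Longrightarrow> x * y \<in> F"
    and inverse_closed: "x \<in> F \<Longrightarrow> inverse x \<in> F"
begin

lemma uminus_closed: "x \<in> F \<Longrightarrow> - x \<in> F"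
  using diff_closed[OF zero_closed] by fastforce

lemma add_closed: "x \<in> F \<Longrightarrow> y \<in> F \<Longrightarrow> x + y \<in> F"
  using diff_closed[of x "- y"] uminus_closed by simp

lemma divide_closed: "x \<in> F \<Longrightarrow> y \<in> F \<Longrightarrow> x / y \<in> F"
  by (simp add: divide_inverse mult_closed inverse_closed)

lemma sum_closed: "(\<And>i. i \<in> A \<Longrightarrow> f i \<in> F) \<Longrightarrow> sum f A \<in> F"
  by (induction A rule: infinite_finite_induct) (auto intro: zero_closed add_closed)

section \<open>Spans of finitely many sequences, and elimination over a subfield\<close>

lemma lspan_base: "finite I \<Longrightarrow> i \<in> I \<Longrightarrow> b i \<in> lspan F I b"
  unfolding lspan_def
  by (auto intro!: exI[of _ "\<lambda>k. if k = i then 1 else 0"] zero_closed one_closed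
      simp: if_distrib[of "\<lambda>c. c * _"] sum.delta cong: if_cong)

lemma lspan_zero: "(\<lambda>j. 0) \<in> lspan F I b"
  unfolding lspan_def by (auto intro!: exI[of _ "\<lambda>k. 0"] zero_closed)

lemma lspan_add:
  assumes "f \<in> lspan F I b" "g \<in> lspan F I b"
  shows "(\<lambda>j. f j + g j) \<in> lspan F I b"
proof -
  obtain M N where "\<forall>k\<in>I. M k \<in> F" "\<forall>j. f j = (\<Sum>k\<in>I. M k * b k j)"
    "\<forall>k\<in>I. N k \<in> F" "\<forall>j. g j = (\<Sum>k\<in>I. N k * b k j)"
    using assms by (auto simp: lspan_def)
  then show ?thesis
    unfolding lspan_def
    by (auto intro!: exI[of _ "\<lambda>k. M k + N k"] add_closed simp: sum.distrib distrib_right)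
qed

lemma lspan_scale:
  assumes "c \<in> F" "f \<in> lspan F I b"
  shows "(\<lambda>j. c * f j) \<in> lspan F I b"
proof -
  obtain M where "\<forall>k\<in>I. M k \<in> F" "\<forall>j. f j = (\<Sum>k\<in>I. M k * b k j)"
    using assms by (auto simp: lspan_def)
  then show ?thesis
    unfolding lspan_def
    by (auto intro!: exI[of _ "\<lambda>k. c * M k"] mult_closed assms(1) simp: sum_distrib_left mult.assoc)
qed

lemma lspan_diff:
  assumes "f \<in> lspan F I b" "g \<in> lspan F I b"
  shows "(\<lambda>j. f j - g j) \<in> lspan F I b"
  using lspan_add[OF assms(1) lspan_scale[OF uminus_closed[OF one_closed] assms(2)]] by simp

lemma lspan_sum:
  "(\<And>i. i \<in> A \<Longrightarrow> f i \<in> lspan F I b) \<Longrightarrow> (\<lambda>j. \<Sum>i\<in>A. f i j) \<in> lspan F I b"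
  by (induction A rule: infinite_finite_induct) (auto intro: lspan_zero lspan_add)

lemma lspan_trans:
  assumes "f \<in> lspan F I b" "\<And>i. i \<in> I \<Longrightarrow> b i \<in> lspan F I' b'"
  shows "f \<in> lspan F I' b'"
proof -
  obtain M where "\<forall>k\<in>I. M k \<in> F" "\<forall>j. f j = (\<Sum>k\<in>I. M k * b k j)"
    using assms by (auto simp: lspan_def)
  moreover from this have "(\<lambda>j. \<Sum>k\<in>I. M k * b k j) \<in> lspan F I' b'"
    by (intro lspan_sum lspan_scale assms(2)) auto
  ultimately show ?thesis
    by presburger
qed

text \<open>As in a tensor product, the products of generators, indexed by pairs, generate the
  products of sequences.\<close>

lemma lspan_mult:
  assumes "f \<in> lspan F I b" "g \<in> lspan F J c"
  shows "(\<lambda>j. f j * g j) \<in> lspan F (I \<times> J) (\<lambda>(i, k) j. b i j * c k j)"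
proof -
  obtain M N where "\<forall>k\<in>I. M k \<in> F" "\<forall>j. f j = (\<Sum>k\<in>I. M k * b k j)"
    "\<forall>k\<in>J. N k \<in> F" "\<forall>j. g j = (\<Sum>k\<in>J. N k * c k j)"
    using assms by (auto simp: lspan_def)
  then show ?thesis
    unfolding lspan_def
    by (auto intro!: exI[of _ "\<lambda>(i, k). M i * N k"] mult_closed sum.cong
        simp: sum_product sum.cartesian_product mult_ac)
qed

text \<open>Gaussian elimination by induction on the set of coordinates: a vector that is nonzero at
  the new coordinate serves as pivot and drops out, so the vectors still outnumber the
  coordinates.\<close>

lemma linear_dependence:
  assumes "finite I" "finite J" "card I < card J" "\<And>j i. j \<in> J \<Longrightarrow> i \<in> I \<Longrightarrow> v j i \<in> F"
  shows "\<exists>c. (\<forall>j\<in>J. c j \<in> F) \<and> (\<exists>j\<in>J. c j \<noteq> 0) \<and> (\<forall>i\<in>I. (\<Sum>j\<in>J. c j * v j i) = 0)"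
  using assms
proof (induction I arbitrary: J v rule: finite_induct)
  case empty
  then show ?case
    by (auto intro!: exI[of _ "\<lambda>_. 1"] one_closed simp: card_gt_0_iff)
next
  case (insert x I)
  show ?case
  proof (cases "\<forall>j\<in>J. v j x = 0")
    case True
    then show ?thesis
      using insert.IH[of J v] insert by auto
  next
    case False
    then obtain r where r: "r \<in> J" "v r x \<noteq> 0"
      by blast
    \<comment> \<open>Fraction-free elimination with pivot \<open>v r x\<close>: coordinate
      \<open>x\<close> of every \<open>w j\<close> is zero.\<close>
    define w where "w j i = v j i * v r x - v r i * v j x" for j i
    have "card I < card (J - {r})"
      using insert r by auto
    moreover have "w j i \<in> F" if "j \<in> J - {r}" "i \<in> I" for j i
      using that r(1) insert.prems unfolding w_def by (intro diff_closed mult_closed) auto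
    ultimately obtain c where c: "\<forall>j\<in>J - {r}. c j \<in> F" "\<exists>j\<in>J - {r}. c j \<noteq> 0"
      "\<forall>i\<in>I. (\<Sum>j\<in>J - {r}. c j * w j i) = 0"
      using insert.IH[of "J - {r}" w] insert.prems by auto
    \<comment> \<open>Lifts the relation among the \<open>w j\<close> to the \<open>v j\<close>; the
      multiples of \<open>v r\<close> contained in the \<open>w j\<close> are collected in the
      coefficient at \<open>r\<close>.\<close>
    define d where "d j = (if j = r then - (\<Sum>j\<in>J - {r}. c j * v j x) else c j * v r x)" for j
    have sum_d: "(\<Sum>j\<in>J. d j * v j i) = (\<Sum>j\<in>J - {r}. c j * w j i)" for i
    proof -
      have "(\<Sum>j\<in>J. d j * v j i) = d r * v r i + (\<Sum>j\<in>J - {r}. d j * v j i)"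
        using insert.prems r(1) by (simp add: sum.remove)
      also have "(\<Sum>j\<in>J - {r}. d j * v j i) = (\<Sum>j\<in>J - {r}. c j * v r x * v j i)"
        by (rule sum.cong) (auto simp: d_def)
      also have "d r * v r i + \<dots> = (\<Sum>j\<in>J - {r}. c j * w j i)"
        by (simp add: d_def w_def sum_distrib_left sum_distrib_right right_diff_distrib
            sum_subtractf mult_ac)
      finally show ?thesis .
    qed
    have "(\<Sum>j\<in>J. d j * v j i) = 0" if "i \<in> insert x I" for i
      using that c(3) unfolding sum_d by (auto simp: w_def)
    moreover have "d j \<in> F" if "j \<in> J" for j
      using that c(1) r insert.prems unfolding d_def
      by (auto intro!: uminus_closed sum_closed mult_closed)
    moreover have "\<exists>j\<in>J. d j \<noteq> 0"
      using c(2) r(2) by (auto simp: d_def)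
    ultimately show ?thesis
      by blast
  qed
qed

section \<open>Passage between shift-closed spans and recurrences\<close>

lemma lspan_shift:
  assumes "shift_closed F I b" "f \<in> lspan F I b"
  shows "(\<lambda>j. f (j + n)) \<in> lspan F I b"
proof (induction n)
  case 0
  then show ?case
    using assms(2) by simp
next
  case (Suc n)
  then obtain M where M: "\<forall>k\<in>I. M k \<in> F" "\<forall>j. f (j + n) = (\<Sum>k\<in>I. M k * b k j)"
    by (auto simp: lspan_def)
  have "(\<lambda>j. \<Sum>k\<in>I. M k * b k (Suc j)) \<in> lspan F I b"
    using assms(1) M(1) unfolding shift_closed_def by (intro lspan_sum lspan_scale) auto
  moreover have "f (j + Suc n) = (\<Sum>k\<in>I. M k * b k (Suc j))" for j
    using M(2)[rule_format, of "Suc j"] by simp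
  ultimately show ?case
    by presburger
qed

text \<open>The first \<open>card I + 1\<close> positive shifts of \<open>f\<close> outnumber the
  generators and are therefore dependent; solving a dependence for its highest shift gives a
  recurrence.\<close>

lemma linear_recurrence_lspan:
  assumes "shift_closed F I b" "f \<in> lspan F I b"
  shows "satisfies_linear_recurrence F f"
proof -
  have "finite I"
    using assms(1) by (simp add: shift_closed_def)
  have "\<exists>M. (\<forall>k\<in>I. M k \<in> F) \<and> (\<forall>j. f (j + n) = (\<Sum>k\<in>I. M k * b k j))" for n
    using lspan_shift[OF assms, of n] by (simp add: lspan_def)
  then obtain v where v: "\<And>n k. k \<in> I \<Longrightarrow> v n k \<in> F"
    "\<And>n j. f (j + n) = (\<Sum>k\<in>I. v n k * b k j)"
    by metis
  \<comment> \<open>The shifts start at 1 rather than 0, which keeps the order \<open>s\<close> at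
    least 1 even for the zero sequence.\<close>
  obtain c where c: "\<forall>n\<in>{1..Suc (card I)}. c n \<in> F" "\<exists>n\<in>{1..Suc (card I)}. c n \<noteq> 0"
    "\<forall>k\<in>I. (\<Sum>n\<in>{1..Suc (card I)}. c n * v n k) = 0"
    using linear_dependence[OF \<open>finite I\<close>, of "{1..Suc (card I)}" v] v(1) by auto
  define s where "s = Max {n \<in> {1..Suc (card I)}. c n \<noteq> 0}"
  have "s \<in> {n \<in> {1..Suc (card I)}. c n \<noteq> 0}"
    unfolding s_def by (rule Max_in) (use c(2) in auto)
  then have s: "s \<ge> 1" "s \<le> Suc (card I)" "c s \<noteq> 0"
    by auto
  have above: "c n = 0" if "n \<in> {1..Suc (card I)}" "n > s" for n
  proof (rule ccontr)
    assume "c n \<noteq> 0"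
    then have "n \<le> s"
      unfolding s_def using that(1) by (intro Max_ge) auto
    with that(2) show False
      by simp
  qed
  have "(\<Sum>n\<in>{1..Suc (card I)}. c n * f (j + n)) = 0" for j
  proof -
    have "(\<Sum>n\<in>{1..Suc (card I)}. c n * f (j + n)) =
        (\<Sum>n\<in>{1..Suc (card I)}. \<Sum>k\<in>I. c n * v n k * b k j)"
      unfolding v(2) by (simp add: sum_distrib_left mult.assoc)
    also have "\<dots> = (\<Sum>k\<in>I. \<Sum>n\<in>{1..Suc (card I)}. c n * v n k * b k j)"
      by (rule sum.swap)
    also have "\<dots> = (\<Sum>k\<in>I. (\<Sum>n\<in>{1..Suc (card I)}. c n * v n k) * b k j)"
      by (rule sum.cong[OF refl], rule sum_distrib_right[symmetric])
    finally show ?thesis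
      using c(3) by simp
  qed
  moreover have "(\<Sum>n\<in>{1..Suc (card I)}. c n * f (j + n)) = (\<Sum>n\<in>{1..s}. c n * f (j + n))" for j
    using s(2) above by (intro sum.mono_neutral_right) auto
  moreover have "(\<Sum>n\<in>{1..s}. c n * f (j + n)) =
      c s * f (j + s) + (\<Sum>n\<in>{1..<s}. c n * f (j + n))" for j
    using s(1) by (simp add: sum.last_plus)
  ultimately have "c s * f (j + s) + (\<Sum>n\<in>{1..<s}. c n * f (j + n)) = 0" for j
    by metis
  then have "c s * f (j + s) = - (\<Sum>n\<in>{1..<s}. c n * f (j + n))" for j
    by (simp only: eq_neg_iff_add_eq_0)
  then have "f (j + s) = - (\<Sum>n\<in>{1..<s}. c n * f (j + n)) / c s" for j
    using s(3) by (metis nonzero_mult_div_cancel_left)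
  then have rec: "f (j + s) = (\<Sum>n\<in>{1..<s}. - (c n / c s) * f (j + n))" for j
    by (simp add: sum_negf sum_divide_distrib)
  \<comment> \<open>Shift 0 takes no part in the dependence, so its coefficient is 0.\<close>
  define \<alpha> where "\<alpha> n = (if n = 0 then 0 else - (c n / c s))" for n
  have "f (j + s) = (\<Sum>k<s. \<alpha> k * f (j + k))" for j
    unfolding rec[of j] by (rule sum.mono_neutral_cong_left) (auto simp: \<alpha>_def)
  moreover have "\<alpha> k \<in> F" if "k < s" for k
  proof (cases "k = 0")
    case False
    with that s(2) have "c k \<in> F" "c s \<in> F"
      using c(1) s(1) by simp_all
    then show ?thesis
      unfolding \<alpha>_def by (simp add: uminus_closed divide_closed zero_closed)
  qed (simp add: \<alpha>_def zero_closed)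
  ultimately have "(\<forall>k<s. \<alpha> k \<in> F) \<and> (\<forall>j. f (j + s) = (\<Sum>k<s. \<alpha> k * f (j + k)))"
    by simp
  with s(1) show ?thesis
    unfolding satisfies_linear_recurrence_def by (intro exI[of _ s] exI[of _ \<alpha>] conjI) simp_all
qed

text \<open>The shifts by less than the order generate a shift-closed space: the recurrence is
  called upon only to shift the last of them.\<close>

lemma linear_recurrence_shift_closed:
  assumes "satisfies_linear_recurrence F a"
  obtains s :: nat where "shift_closed F {..<s} (\<lambda>i j. a (j + i))"
    "a \<in> lspan F {..<s} (\<lambda>i j. a (j + i))"
proof -
  obtain s \<alpha> where s: "s \<ge> 1" "\<forall>k<s. \<alpha> k \<in> F" "\<And>j. a (j + s) = (\<Sum>k<s. \<alpha> k * a (j + k))"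
    using assms by (auto simp: satisfies_linear_recurrence_def)
  let ?b = "\<lambda>i j. a (j + i)"
  have base: "?b i \<in> lspan F {..<s} ?b" if "i < s" for i
    by (rule lspan_base) (use that in auto)
  have "(\<lambda>j. ?b i (Suc j)) \<in> lspan F {..<s} ?b" if "i < s" for i
  proof (cases "Suc i < s")
    case True
    then show ?thesis
      using base[of "Suc i"] by simp
  next
    case False
    with that have "Suc i = s"
      by simp
    then have "(\<lambda>j. ?b i (Suc j)) = (\<lambda>j. \<Sum>k<s. \<alpha> k * a (j + k))"
      using s(3) by (metis add_Suc_shift)
    then show ?thesis
      using s(2) base by (auto intro!: lspan_sum lspan_scale)
  qed
  then have "shift_closed F {..<s} ?b"
    by (simp add: shift_closed_def)
  moreover have "a \<in> lspan F {..<s} ?b"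
    using base[of 0] s(1) by simp
  ultimately show thesis
    by (rule that)
qed

section \<open>Closure of recurrent sequences under ring operations and delays\<close>

lemma linear_recurrence_diff_add:
  assumes "satisfies_linear_recurrence F f" "satisfies_linear_recurrence F g"
  shows linear_recurrence_diff: "satisfies_linear_recurrence F (\<lambda>j. f j - g j)"
    and linear_recurrence_add: "satisfies_linear_recurrence F (\<lambda>j. f j + g j)"
proof -
  obtain s :: nat and t :: nat
    where s: "shift_closed F {..<s} (\<lambda>i j. f (j + i))" "f \<in> lspan F {..<s} (\<lambda>i j. f (j + i))"
      and t: "shift_closed F {..<t} (\<lambda>i j. g (j + i))" "g \<in> lspan F {..<t} (\<lambda>i j. g (j + i))"
    using assms linear_recurrence_shift_closed by metis
  \<comment> \<open>The disjoint union of the two generating families spans a shift-closed space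
    that contains both sequences.\<close>
  let ?I = "{..<s} <+> {..<t}" and ?b = "case_sum (\<lambda>i j. f (j + i)) (\<lambda>i j. g (j + i))"
  have l: "h \<in> lspan F ?I ?b" if "h \<in> lspan F {..<s} (\<lambda>i j. f (j + i))" for h
    using that by (rule lspan_trans) (use lspan_base[of ?I "Inl _" ?b] in auto)
  have r: "h \<in> lspan F ?I ?b" if "h \<in> lspan F {..<t} (\<lambda>i j. g (j + i))" for h
    using that by (rule lspan_trans) (use lspan_base[of ?I "Inr _" ?b] in auto)
  have "shift_closed F ?I ?b"
    using s(1) t(1) l r unfolding shift_closed_def by auto
  moreover have "f \<in> lspan F ?I ?b" "g \<in> lspan F ?I ?b"
    using l r s(2) t(2) by auto
  ultimately show "satisfies_linear_recurrence F (\<lambda>j. f j - g j)"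
    "satisfies_linear_recurrence F (\<lambda>j. f j + g j)"
    by (auto intro: linear_recurrence_lspan lspan_diff lspan_add)
qed

lemma linear_recurrence_mult:
  assumes "satisfies_linear_recurrence F f" "satisfies_linear_recurrence F g"
  shows "satisfies_linear_recurrence F (\<lambda>j. f j * g j)"
proof -
  obtain s :: nat and t :: nat
    where s: "shift_closed F {..<s} (\<lambda>i j. f (j + i))" "f \<in> lspan F {..<s} (\<lambda>i j. f (j + i))"
      and t: "shift_closed F {..<t} (\<lambda>i j. g (j + i))" "g \<in> lspan F {..<t} (\<lambda>i j. g (j + i))"
    using assms linear_recurrence_shift_closed by metis
  let ?b = "\<lambda>(i, k) j. f (j + i) * g (j + k)"
  have "shift_closed F ({..<s} \<times> {..<t}) ?b"
    using s(1) t(1) lspan_mult unfolding shift_closed_def by fastforce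
  then show ?thesis
    using lspan_mult[OF s(2) t(2)] by (rule linear_recurrence_lspan)
qed

lemma linear_recurrence_periodic:
  assumes "p \<ge> 1" "\<And>j. a (j + p) = a j"
  shows "satisfies_linear_recurrence F a"
  unfolding satisfies_linear_recurrence_def
  using assms
  by (intro exI[of _ p] conjI exI[of _ "\<lambda>k. if k = 0 then 1 else 0"])
    (auto simp: zero_closed one_closed if_distrib[of "\<lambda>c. c * _"] sum.delta cong: if_cong)

lemma linear_recurrence_const: "satisfies_linear_recurrence F (\<lambda>j. c)"
  by (rule linear_recurrence_periodic[of 1]) auto

lemma linear_recurrence_shift:
  assumes "satisfies_linear_recurrence F a"
  shows "satisfies_linear_recurrence F (\<lambda>j. a (j + n))"
proof -
  obtain s :: nat where s: "shift_closed F {..<s} (\<lambda>i j. a (j + i))"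
    "a \<in> lspan F {..<s} (\<lambda>i j. a (j + i))"
    using assms by (rule linear_recurrence_shift_closed)
  show ?thesis
    using s(1) lspan_shift[OF s] by (rule linear_recurrence_lspan)
qed

text \<open>A longer recurrence with coefficient 0 on the first \<open>n\<close> terms of each
  window never sees the values before index \<open>n\<close>, so finite delays are harmless.\<close>

lemma linear_recurrence_unshift:
  assumes "satisfies_linear_recurrence F (\<lambda>j. a (j + n))"
  shows "satisfies_linear_recurrence F a"
proof -
  obtain s \<alpha> where s: "s \<ge> 1" "\<forall>k<s. \<alpha> k \<in> F"
    "\<And>j. a (j + s + n) = (\<Sum>k<s. \<alpha> k * a (j + k + n))"
    using assms by (auto simp: satisfies_linear_recurrence_def)
  define \<beta> where "\<beta> k = (if k < n then 0 else \<alpha> (k - n))" for k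
  have "a (j + (s + n)) = (\<Sum>k<s + n. \<beta> k * a (j + k))" for j
  proof -
    have "a (j + (s + n)) = (\<Sum>k\<in>{0..<s}. \<beta> (k + n) * a (j + (k + n)))"
      using s(3)[of j] by (simp add: \<beta>_def add.assoc atLeast0LessThan)
    also have "\<dots> = (\<Sum>k\<in>{0 + n..<s + n}. \<beta> k * a (j + k))"
      by (rule sum.shift_bounds_nat_ivl[symmetric])
    also have "\<dots> = (\<Sum>k<s + n. \<beta> k * a (j + k))"
      by (rule sum.mono_neutral_left) (auto simp: \<beta>_def)
    finally show ?thesis .
  qed
  moreover have "\<forall>k<s + n. \<beta> k \<in> F"
    using s(2) by (auto simp: \<beta>_def zero_closed)
  ultimately show ?thesis
    unfolding satisfies_linear_recurrence_def using s(1)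
    by (intro exI[of _ "s + n"] exI[of _ \<beta>] conjI allI) simp_all
qed

text \<open>
  Multiplying the sequences by the indicator functions of the residue classes modulo \<open>p\<close> makes
  the periodic coefficients constant.
\<close>

lemma linear_recurrence_periodic_coefficients:
  fixes y :: "'c::finite \<Rightarrow> nat \<Rightarrow> 'a" and p m l :: nat
  assumes "p \<ge> 1" "l < m" "\<And>c j. g c j \<in> F" "\<And>c j. g c (j + p) = g c j"
    and rec: "\<And>c j. y c (j + m) = g c j * y (d c) (j + l) - y (e c) j"
  shows "satisfies_linear_recurrence F (y c)"
proof -
  let ?I = "{..<p} \<times> (UNIV :: 'c set) \<times> {..<m}"
  define b where "b = (\<lambda>(k, c, i) j. if j mod p = k then y c (j + i) else 0)"
  have base: "(\<lambda>j. if j mod p = k then y c (j + i) else 0) \<in> lspan F ?I b"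
    if "k < p" "i < m" for k c i
    using lspan_base[of ?I "(k, c, i)" b] that by (simp add: b_def)
  have g_mod: "g c (j mod p) = g c j" for c j
  proof -
    have "g c (r + n * p) = g c r" for r n
    proof (induction n)
      case (Suc n)
      then show ?case
        using assms(4)[of c "r + n * p"] by (simp add: ac_simps)
    qed simp
    then show ?thesis
      by (metis mod_div_mult_eq)
  qed
  have "(\<lambda>j. b (k, c, i) (Suc j)) \<in> lspan F ?I b" if "k < p" "i < m" for k c i
  proof -
    \<comment> \<open>The cyclic predecessor of \<open>k\<close>: shifting by one moves the
      indicator of class \<open>k\<close> to that of class \<open>k'\<close>.\<close>
    define k' where "k' = (if k = 0 then p - 1 else k - 1)"
    have k': "k' < p"
      using assms(1) that(1) by (auto simp: k'_def)
    have mod_Suc': "Suc j mod p = k \<longleftrightarrow> j mod p = k'" for j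
      using that(1) by (auto simp: mod_Suc k'_def)
    show ?thesis
    proof (cases "Suc i < m")
      case True
      have "(\<lambda>j. b (k, c, i) (Suc j)) = (\<lambda>j. if j mod p = k' then y c (j + Suc i) else 0)"
        by (rule ext) (simp add: b_def mod_Suc')
      then show ?thesis
        using base[OF k' True, of c] by (simp only:)
    next
      \<comment> \<open>The shift leaves the window, so the recurrence is applied; on class
        \<open>k'\<close> its coefficient is the constant \<open>g c k'\<close>.\<close>
      case False
      with that have "Suc i = m"
        by simp
      have "b (k, c, i) (Suc j) = g c k' * (if j mod p = k' then y (d c) (j + l) else 0) -
          (if j mod p = k' then y (e c) (j + 0) else 0)" for j
      proof (cases "j mod p = k'")
        case True
        with g_mod[of c j] \<open>Suc i = m\<close> show ?thesis
          using rec[of c j] by (simp add: b_def mod_Suc' flip: add_Suc_right)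
      qed (simp add: b_def mod_Suc')
      then have "(\<lambda>j. b (k, c, i) (Suc j)) =
          (\<lambda>j. g c k' * (if j mod p = k' then y (d c) (j + l) else 0) -
            (if j mod p = k' then y (e c) (j + 0) else 0))"
        by (rule ext)
      moreover have "(\<lambda>j. g c k' * (if j mod p = k' then y (d c) (j + l) else 0) -
          (if j mod p = k' then y (e c) (j + 0) else 0)) \<in> lspan F ?I b"
        using assms(2,3) k' by (intro lspan_diff lspan_scale base) auto
      ultimately show ?thesis
        by (simp only:)
    qed
  qed
  then have "shift_closed F ?I b"
    by (auto simp: shift_closed_def)
  \<comment> \<open>The restrictions to the residue classes add up to \<open>y c\<close>.\<close>
  moreover have "(\<lambda>j. \<Sum>k<p. if j mod p = k then y c (j + 0) else 0) \<in> lspan F ?I b"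
    using assms(2) by (intro lspan_sum base) auto
  ultimately have "satisfies_linear_recurrence F (\<lambda>j. \<Sum>k<p. if j mod p = k then y c (j + 0) else 0)"
    by (rule linear_recurrence_lspan)
  moreover have "(\<lambda>j. \<Sum>k<p. if j mod p = k then y c (j + 0) else 0) = y c"
    using assms(1) by (simp add: sum.delta')
  ultimately show ?thesis
    by simp
qed


section \<open>Frieze relations of affine types\<close>

text \<open>For moving one vertex further along an arm: the next sequence \<open>r\<close> is a
  polynomial in shifts of sequences already known to be recurrent.\<close>

lemma linear_recurrence_continuant:
  assumes "satisfies_linear_recurrence F x" "satisfies_linear_recurrence F y"
    "satisfies_linear_recurrence F z" "\<And>j. x (j + n) * y j = r j + z j"
  shows "satisfies_linear_recurrence F r"
proof -
  have "r = (\<lambda>j. x (j + n) * y j - z j)"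
    using assms(4) by auto
  then show ?thesis
    using linear_recurrence_diff[OF linear_recurrence_mult[OF linear_recurrence_shift[OF assms(1)] assms(2)] assms(3)]
    by simp
qed

text \<open>The quotient \<open>K\<close> is conserved: the half-steps from \<open>x\<close> to
  \<open>y\<close> and back carry the same factor. Eliminating one sequence leaves a recurrence of
  order two with middle coefficient K^2 - 2 for the other.\<close>

lemma linear_recurrence_A12:
  assumes F: "\<And>j. x j \<in> F" "\<And>j. y j \<in> F"
    and nz: "\<And>j. x j \<noteq> 0" "\<And>j. y j \<noteq> 0"
    and x: "\<And>j. x (Suc j) * x j = 1 + y j ^ 2"
    and y: "\<And>j. y (Suc j) * y j = 1 + x (Suc j) ^ 2"
  shows "satisfies_linear_recurrence F x" "satisfies_linear_recurrence F y"
proof -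
  define K where "K j = (x (Suc j) + x j) / y j" for j
  have K1: "x (Suc j) + x j = K j * y j" for j
    using nz by (simp add: K_def)
  have "(x (Suc j) + x j) * x (Suc j) = (y (Suc j) + y j) * y j" for j
    using x[of j] y[of j] by algebra
  then have K2: "y (Suc j) + y j = K j * x (Suc j)" for j
    using nz by (simp add: K_def field_simps)
  have "(x (Suc (Suc j)) + x (Suc j)) * x (Suc j) = (y (Suc j) + y j) * y (Suc j)" for j
    using x[of "Suc j"] y[of j] by algebra
  then have "x (Suc j) * (x (Suc (Suc j)) + x (Suc j)) = x (Suc j) * (K j * y (Suc j))" for j
    by (simp only: K2) (simp only: ac_simps)
  then have K3: "x (Suc (Suc j)) + x (Suc j) = K j * y (Suc j)" for j
    using nz by simp
  have K_Suc: "K (Suc j) = K j" for j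
    using K1[of "Suc j"] K3[of j] nz by simp
  then have K: "K j = K 0" for j
    by (induction j) auto
  have "K 0 \<in> F"
    unfolding K_def by (intro divide_closed add_closed F)
  then have "K 0 * K 0 - (1 + 1) \<in> F"
    by (intro diff_closed mult_closed add_closed one_closed)
  moreover have "x (j + 2) = (K 0 * K 0 - (1 + 1)) * x (j + 1) - x j" for j
    using K1[of j] K1[of "Suc j"] K2[of j] by (simp add: K[of j] K[of "Suc j"]) algebra
  moreover have "y (j + 2) = (K 0 * K 0 - (1 + 1)) * y (j + 1) - y j" for j
    using K1[of "Suc j"] K2[of j] K2[of "Suc j"] by (simp add: K[of j] K[of "Suc j"]) algebra
  \<comment> \<open>Period 1 and a single sequence, indexed by \<open>unit\<close>: the case of
    constant coefficients.\<close>
  ultimately show "satisfies_linear_recurrence F x" "satisfies_linear_recurrence F y"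
    using linear_recurrence_periodic_coefficients[of 1 1 2 "\<lambda>_ _. K 0 * K 0 - (1 + 1)"
        "\<lambda>_::unit. x" "\<lambda>_. ()" "\<lambda>_. ()"]
      linear_recurrence_periodic_coefficients[of 1 1 2 "\<lambda>_ _. K 0 * K 0 - (1 + 1)"
        "\<lambda>_::unit. y" "\<lambda>_. ()" "\<lambda>_. ()"]
    by simp_all
qed

text \<open>
  Identifying three of the four leaves of affine \<open>D\<^sub>4\<close> gives type \<open>G\<^sub>2\<^sub>2\<close>, identifying all of
  them (\<open>u = v\<close>) gives \<open>A\<^sub>1\<^sub>1\<close>.
\<close>

lemma linear_recurrence_D4:
  assumes F: "\<And>j. u j \<in> F" "\<And>j. v j \<in> F"
    and nz: "\<And>j. u j \<noteq> 0" "\<And>j. v j \<noteq> 0" "\<And>j. p j \<noteq> 0"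
    and u: "\<And>j. u (Suc j) * u j = 1 + p j"
    and v: "\<And>j. v (Suc j) * v j = 1 + p j"
    and p: "\<And>j. p (Suc j) * p j = 1 + u (Suc j) * v (Suc j) ^ 3"
  shows "satisfies_linear_recurrence F u" "satisfies_linear_recurrence F v"
    "satisfies_linear_recurrence F p"
proof -
  \<comment> \<open>The periodic factor J of this type; its period will be 2.\<close>
  define A where "A j = (v (j + 2) + v j) / v (j + 1)" for j
  \<comment> \<open>In \<open>u2\<close> and \<open>v2\<close> the relations at a leaf and at the
    centre combine to a multiple of the middle leaf term, which cancels. \<open>u0\<close> and
    \<open>v0\<close> are the time reversals.\<close>
  have u2: "u (j + 2) * p j = v (j + 1) ^ 3 + u j" for j
  proof -
    have "u (j + 1) * (u (j + 2) * p j) = u (j + 1) * (v (j + 1) ^ 3 + u j)"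
      using u[of "j + 1"] p[of j] u[of j] by simp algebra
    then show ?thesis
      using nz by simp
  qed
  have v2: "v (j + 2) * p j = u (j + 1) * v (j + 1) ^ 2 + v j" for j
  proof -
    have "v (j + 1) * (v (j + 2) * p j) = v (j + 1) * (u (j + 1) * v (j + 1) ^ 2 + v j)"
      using v[of "j + 1"] p[of j] v[of j] by simp algebra
    then show ?thesis
      using nz by simp
  qed
  have u0: "u j * p (j + 1) = v (j + 1) ^ 3 + u (j + 2)" for j
  proof -
    have "u (j + 1) * (u j * p (j + 1)) = u (j + 1) * (v (j + 1) ^ 3 + u (j + 2))"
      using u[of "j + 1"] p[of j] u[of j] by simp algebra
    then show ?thesis
      using nz by simp
  qed
  have v0: "v j * p (j + 1) = u (j + 1) * v (j + 1) ^ 2 + v (j + 2)" for j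
  proof -
    have "v (j + 1) * (v j * p (j + 1)) = v (j + 1) * (u (j + 1) * v (j + 1) ^ 2 + v (j + 2))"
      using v[of "j + 1"] p[of j] v[of j] by simp algebra
    then show ?thesis
      using nz by simp
  qed
  \<comment> \<open>\<open>1\<close> rewrites \<open>A j\<close> as
    \<open>(u (j + 3) + u (j + 1)) / v (j + 2)\<close>, and \<open>2\<close> rewrites it as
    \<open>(v (j + 3) + v (j + 1)) / u (j + 2)\<close>.\<close>
  have 1: "(v (j + 2) + v j) * v (j + 2) = (u (j + 3) + u (j + 1)) * v (j + 1)" for j
  proof -
    have "p (j + 1) * ((v (j + 2) + v j) * v (j + 2)) =
        p (j + 1) * ((u (j + 3) + u (j + 1)) * v (j + 1))"
      using v0[of j] u2[of "j + 1"] v[of "j + 1"] u[of "j + 1"]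
      by (simp add: numeral_3_eq_3) algebra
    then show ?thesis
      using nz by simp
  qed
  have 2: "(v (j + 2) + v j) * u (j + 2) = (v (j + 3) + v (j + 1)) * v (j + 1)" for j
  proof -
    have "p (j + 1) * ((v (j + 2) + v j) * u (j + 2)) =
        p (j + 1) * ((v (j + 3) + v (j + 1)) * v (j + 1))"
      using v0[of j] v2[of "j + 1"] v[of "j + 1"] u[of "j + 1"]
      by (simp add: numeral_3_eq_3) algebra
    then show ?thesis
      using nz by simp
  qed
  \<comment> \<open>The time reversal of \<open>2\<close>: the same quotient over
    \<open>u (j + 2)\<close>, now equated with \<open>A (j + 2)\<close>.\<close>
  have 3: "(v (j + 4) + v (j + 2)) * u (j + 2) = (v (j + 3) + v (j + 1)) * v (j + 3)" for j
  proof -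
    have "p (j + 2) * ((v (j + 4) + v (j + 2)) * u (j + 2)) =
        p (j + 2) * ((v (j + 3) + v (j + 1)) * v (j + 3))"
      using v0[of "j + 1"] v2[of "j + 2"] v[of "j + 2"] u[of "j + 2"]
      by (simp add: numeral_3_eq_3 eval_nat_numeral) algebra
    then show ?thesis
      using nz by simp
  qed
  have A: "A j \<in> F" for j
    unfolding A_def by (intro divide_closed add_closed F)
  have period: "A (j + 2) = A j" for j
  proof -
    have "u (j + 2) * ((v (j + 4) + v (j + 2)) * v (j + 1)) =
        u (j + 2) * ((v (j + 2) + v j) * v (j + 3))"
      using 2[of j] 3[of j] by algebra
    then have "(v (j + 4) + v (j + 2)) * v (j + 1) = (v (j + 2) + v j) * v (j + 3)"
      using nz by simp
    then show ?thesis
      using nz by (simp add: A_def frac_eq_eq eval_nat_numeral)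
  qed
  have rv: "v (j + 2) = A j * v (j + 1) - v j" for j
    using nz by (simp add: A_def)
  have ru: "u (j + 3) = A j * v (j + 2) - u (j + 1)" for j
    using nz 1[of j] by (simp add: A_def field_simps)
  \<comment> \<open>\<open>v\<close> obeys its own recurrence and drives \<open>u\<close>. The start
    at index 1 comes from \<open>ru\<close>, which does not reach \<open>u 0\<close>.\<close>
  have "satisfies_linear_recurrence F (if c then (\<lambda>j. u (j + 1)) else (\<lambda>j. v (j + 1)))" for c
    by (rule linear_recurrence_periodic_coefficients[of 2 1 2 "\<lambda>c j. A (if c then j else j + 1)"
          "\<lambda>c. if c then (\<lambda>j. u (j + 1)) else (\<lambda>j. v (j + 1))" "\<lambda>_. False" id])
      (use A period ru rv[of "_ + 1"] in \<open>auto simp: eval_nat_numeral\<close>)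
  from this[of True] this[of False] show *: "satisfies_linear_recurrence F u" 
    "satisfies_linear_recurrence F v"
    using linear_recurrence_unshift[of u 1] linear_recurrence_unshift[of v 1] by simp_all
  show "satisfies_linear_recurrence F p"
    by (rule linear_recurrence_continuant[of u u "\<lambda>_. 1" 1])
      (use u * linear_recurrence_const in \<open>simp_all add: add.commute\<close>)
qed


text \<open>
  Identifying two of the three arms of affine \<open>E\<^sub>6\<close> gives type \<open>F\<^sub>4\<^sub>2\<close>, identifying all of them
  (\<open>u = v\<close>, \<open>p = q\<close>) gives \<open>G\<^sub>2\<^sub>1\<close>.  Here \<open>u\<close> and \<open>v\<close> belong to the leaves and \<open>c\<close> to the centre.
\<close>

lemma linear_recurrence_E6:
  assumes F: "\<And>j. u j \<in> F" "\<And>j. v j \<in> F"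
    and nz: "\<And>j. u j \<noteq> 0" "\<And>j. v j \<noteq> 0" "\<And>j. p j \<noteq> 0" "\<And>j. q j \<noteq> 0" "\<And>j. c j \<noteq> 0"
    and u: "\<And>j. u (Suc j) * u j = 1 + p j"
    and v: "\<And>j. v (Suc j) * v j = 1 + q j"
    and p: "\<And>j. p (Suc j) * p j = 1 + u (Suc j) * c j"
    and q: "\<And>j. q (Suc j) * q j = 1 + v (Suc j) * c j"
    and c: "\<And>j. c (Suc j) * c j = 1 + p (Suc j) * q (Suc j) ^ 2"
  shows "satisfies_linear_recurrence F u" "satisfies_linear_recurrence F v"
    "satisfies_linear_recurrence F p" "satisfies_linear_recurrence F q"
    "satisfies_linear_recurrence F c"
proof -
  \<comment> \<open>Both arms obey the same relations towards the centre, so the first identity and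
    its time reversal are derived for a generic arm.\<close>
  have step: "y (j + 2) * r j = c j + y j" "y j * r (j + 1) = c j + y (j + 2)"
    if "\<And>j. y (Suc j) * y j = 1 + r j" "\<And>j. r (Suc j) * r j = 1 + y (Suc j) * c j"
      "\<And>j. y j \<noteq> 0" for y r :: "nat \<Rightarrow> 'a" and j
  proof -
    have "y (j + 1) * (y (j + 2) * r j) = y (j + 1) * (c j + y j)"
      "y (j + 1) * (y j * r (j + 1)) = y (j + 1) * (c j + y (j + 2))"
      using that(1)[of j] that(1)[of "j + 1"] that(2)[of j] by simp_all algebra+
    then show "y (j + 2) * r j = c j + y j" "y j * r (j + 1) = c j + y (j + 2)"
      using that(3) by simp_all
  qed
  note u2 = step[of u p, OF u p nz(1)] and v2 = step[of v q, OF v q nz(2)]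
  \<comment> \<open>Further cancellations lead to the centre (\<open>v3\<close>) and across it
    (\<open>v4\<close>), each formula paired with its time reversal.\<close>
  have v3: "v (j + 3) * c j = q j + p (j + 1) * q (j + 1)"
    "v j * c (j + 1) = q (j + 2) + p (j + 1) * q (j + 1)"
    "u (j + 3) * c j = p j + q (j + 1) ^ 2"
    "u j * c (j + 1) = p (j + 2) + q (j + 1) ^ 2" for j
  proof -
    have "q (j + 1) * (v (j + 3) * c j) = q (j + 1) * (q j + p (j + 1) * q (j + 1))"
      "q (j + 1) * (v j * c (j + 1)) = q (j + 1) * (q (j + 2) + p (j + 1) * q (j + 1))"
      "p (j + 1) * (u (j + 3) * c j) = p (j + 1) * (p j + q (j + 1) ^ 2)"
      "p (j + 1) * (u j * c (j + 1)) = p (j + 1) * (p (j + 2) + q (j + 1) ^ 2)"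
      using v2(1)[of "j + 1"] v2(2)[of j] u2(1)[of "j + 1"] u2(2)[of j] c[of j]
        q[of j] q[of "j + 1"] p[of j] p[of "j + 1"]
      by (simp_all add: eval_nat_numeral) algebra+
    then show "v (j + 3) * c j = q j + p (j + 1) * q (j + 1)"
      "v j * c (j + 1) = q (j + 2) + p (j + 1) * q (j + 1)"
      "u (j + 3) * c j = p j + q (j + 1) ^ 2"
      "u j * c (j + 1) = p (j + 2) + q (j + 1) ^ 2"
      using nz by simp_all
  qed
  have v4: "v j * (p (j + 2) * q (j + 2)) =
      c (j + 2) + u (j + 2) + v (j + 2) + u (j + 2) * v (j + 2) * c (j + 1)"
    "v (j + 4) * (p (j + 1) * q (j + 1)) =
      c j + u (j + 2) + v (j + 2) + u (j + 2) * v (j + 2) * c (j + 1)"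
    "u j * q (j + 2) ^ 2 = c (j + 2) + 2 * v (j + 2) + v (j + 2) ^ 2 * c (j + 1)"
    "u (j + 4) * q (j + 1) ^ 2 = c j + 2 * v (j + 2) + v (j + 2) ^ 2 * c (j + 1)" for j
  proof -
    have "c (j + 1) * (v j * (p (j + 2) * q (j + 2))) =
        c (j + 1) * (c (j + 2) + u (j + 2) + v (j + 2) + u (j + 2) * v (j + 2) * c (j + 1))"
      "c (j + 1) * (u j * q (j + 2) ^ 2) =
        c (j + 1) * (c (j + 2) + 2 * v (j + 2) + v (j + 2) ^ 2 * c (j + 1))"
      using v3(2,4)[of j] c[of "j + 1"] q[of "j + 1"] p[of "j + 1"]
      by (simp_all add: eval_nat_numeral) algebra+
    moreover have "c (j + 1) * (v (j + 4) * (p (j + 1) * q (j + 1))) =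
        c (j + 1) * (c j + u (j + 2) + v (j + 2) + u (j + 2) * v (j + 2) * c (j + 1))"
      "c (j + 1) * (u (j + 4) * q (j + 1) ^ 2) =
        c (j + 1) * (c j + 2 * v (j + 2) + v (j + 2) ^ 2 * c (j + 1))"
      using v3(1,3)[of "j + 1"] c[of j] q[of "j + 1"] p[of "j + 1"]
      by (simp_all add: eval_nat_numeral) algebra+
    ultimately show "v j * (p (j + 2) * q (j + 2)) =
        c (j + 2) + u (j + 2) + v (j + 2) + u (j + 2) * v (j + 2) * c (j + 1)"
      "v (j + 4) * (p (j + 1) * q (j + 1)) =
        c j + u (j + 2) + v (j + 2) + u (j + 2) * v (j + 2) * c (j + 1)"
      "u j * q (j + 2) ^ 2 = c (j + 2) + 2 * v (j + 2) + v (j + 2) ^ 2 * c (j + 1)"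
      "u (j + 4) * q (j + 1) ^ 2 = c j + 2 * v (j + 2) + v (j + 2) ^ 2 * c (j + 1)"
      using nz(5) by (metis mult_left_cancel)+
  qed
  \<comment> \<open>\<open>1\<close>, \<open>2\<close> and \<open>3\<close> equate four quotients,
    from \<open>J j\<close> to \<open>J (j + 3)\<close>. Time reversal exchanges \<open>1\<close>
    with \<open>3\<close> and preserves \<open>2\<close>.\<close>
  have 1: "(v (j + 4) + v j) * v (j + 3) = (v (j + 5) + u (j + 1)) * u (j + 2)" for j
  proof -
    have "(p (j + 2) * q (j + 2)) * ((v (j + 4) + v j) * v (j + 3)) =
        (p (j + 2) * q (j + 2)) * ((v (j + 5) + u (j + 1)) * u (j + 2))"
      using v4(1)[of j] v4(2)[of "j + 1"] v2(1)[of "j + 2"] u2(2)[of "j + 1"] u[of "j + 2"] v[of "j + 2"]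
      by (simp add: eval_nat_numeral) algebra
    then show ?thesis
      using nz by simp
  qed
  have 2: "(v (j + 5) + u (j + 1)) * v (j + 4) = (u (j + 6) + v (j + 2)) * v (j + 3)" for j
  proof -
    have "q (j + 3) ^ 2 * ((v (j + 5) + u (j + 1)) * v (j + 4)) =
        q (j + 3) ^ 2 * ((u (j + 6) + v (j + 2)) * v (j + 3))"
      using v4(3)[of "j + 1"] v4(4)[of "j + 2"] v2(1)[of "j + 3"] v2(2)[of "j + 2"] v[of "j + 3"]
      by (simp add: eval_nat_numeral) algebra
    then show ?thesis
      using nz by simp
  qed
  have 3: "(u (j + 6) + v (j + 2)) * u (j + 5) = (v (j + 7) + v (j + 3)) * v (j + 4)" for j
  proof -
    have "(p (j + 4) * q (j + 4)) * ((u (j + 6) + v (j + 2)) * u (j + 5)) =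
        (p (j + 4) * q (j + 4)) * ((v (j + 7) + v (j + 3)) * v (j + 4))"
      using v4(1)[of "j + 2"] v4(2)[of "j + 3"] v2(2)[of "j + 3"] u2(1)[of "j + 4"] u[of "j + 4"] v[of "j + 4"]
      by (simp add: eval_nat_numeral) algebra
    then show ?thesis
      using nz by simp
  qed
  define J where "J j = (v (j + 4) + v j) / u (j + 2)" for j
  have J: "J j \<in> F" for j
    unfolding J_def by (intro divide_closed add_closed F)
  have J1: "v (j + 4) + v j = J j * u (j + 2)" for j
    using nz by (simp add: J_def)
  have J2: "v (j + 5) + u (j + 1) = J j * v (j + 3)" for j
  proof -
    have "u (j + 2) * (v (j + 5) + u (j + 1)) = u (j + 2) * (J j * v (j + 3))"
      using 1[of j] J1[of j] by algebra
    then show ?thesis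
      using nz by simp
  qed
  have J3: "u (j + 6) + v (j + 2) = J j * v (j + 4)" for j
  proof -
    have "v (j + 3) * (u (j + 6) + v (j + 2)) = v (j + 3) * (J j * v (j + 4))"
      using 2[of j] J2[of j] by algebra
    then show ?thesis
      using nz by simp
  qed
  have period: "J (j + 3) = J j" for j
  proof -
    have "v (j + 4) * u (j + 5) * J (j + 3) = v (j + 4) * u (j + 5) * J j"
      using 3[of j] J3[of j] J1[of "j + 3"] by (simp add: eval_nat_numeral) algebra
    then show ?thesis
      using nz by simp
  qed
  \<comment> \<open>\<open>J3\<close> gives \<open>u (j + 6)\<close> and \<open>J1\<close>, two
    steps later, gives \<open>v (j + 6)\<close>. Both subtract \<open>v (j + 2)\<close>, whence the
    constant selector and the start at index 2.\<close>
  have "satisfies_linear_recurrence F (if b then (\<lambda>j. u (j + 2)) else (\<lambda>j. v (j + 2)))" for b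
    by (rule linear_recurrence_periodic_coefficients[of 3 2 4 "\<lambda>b j. J (if b then j else j + 2)"
          "\<lambda>b. if b then (\<lambda>j. u (j + 2)) else (\<lambda>j. v (j + 2))" Not "\<lambda>_. False"])
      (use J period J1[of "_ + 2"] J3 in \<open>auto simp: eval_nat_numeral eq_diff_eq\<close>)
  from this[of True] this[of False] show *: "satisfies_linear_recurrence F u"
    "satisfies_linear_recurrence F v"
    using linear_recurrence_unshift[of u 2] linear_recurrence_unshift[of v 2] by simp_all
  show p_rec: "satisfies_linear_recurrence F p"
    by (rule linear_recurrence_continuant[of u u "\<lambda>_. 1" 1])
      (use u * linear_recurrence_const in \<open>simp_all add: add.commute\<close>)
  show "satisfies_linear_recurrence F q"
    by (rule linear_recurrence_continuant[of v v "\<lambda>_. 1" 1])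
      (use v * linear_recurrence_const in \<open>simp_all add: add.commute\<close>)
  show "satisfies_linear_recurrence F c"
    using *(1) p_rec *(1) u2(1) by (rule linear_recurrence_continuant)
qed

text \<open>
  Identifying the two long arms of affine \<open>E\<^sub>7\<close> gives type \<open>F\<^sub>4\<^sub>1\<close>.  Here \<open>u\<close> belongs to the end of
  the long arm, \<open>e\<close> to the centre and \<open>w\<close> to the short arm.
\<close>

lemma linear_recurrence_E7:
  assumes F: "\<And>j. u j \<in> F" "\<And>j. w j \<in> F"
    and nz: "\<And>j. u j \<noteq> 0" "\<And>j. p j \<noteq> 0" "\<And>j. c j \<noteq> 0" "\<And>j. e j \<noteq> 0" "\<And>j. w j \<noteq> 0"
    and u: "\<And>j. u (Suc j) * u j = 1 + p j"
    and p: "\<And>j. p (Suc j) * p j = 1 + u (Suc j) * c j"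
    and c: "\<And>j. c (Suc j) * c j = 1 + p (Suc j) * e j"
    and e: "\<And>j. e (Suc j) * e j = 1 + c (Suc j) ^ 2 * w j"
    and w: "\<And>j. w (Suc j) * w j = 1 + e (Suc j)"
  shows "satisfies_linear_recurrence F u" "satisfies_linear_recurrence F p"
    "satisfies_linear_recurrence F c" "satisfies_linear_recurrence F e"
    "satisfies_linear_recurrence F w"
proof -
  \<comment> \<open>Each identity from here to \<open>u6\<close> moves one vertex along the long
    arm, reaching \<open>e\<close> in \<open>u3\<close> and going beyond it from \<open>u4\<close>
    on; the second formula of a pair is the time reversal.\<close>
  have u2: "u (j + 2) * p j = c j + u j" "u j * p (j + 1) = c j + u (j + 2)" for j
  proof -
    have "u (j + 1) * (u (j + 2) * p j) = u (j + 1) * (c j + u j)"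
      "u (j + 1) * (u j * p (j + 1)) = u (j + 1) * (c j + u (j + 2))"
      using u[of j] u[of "j + 1"] p[of j] by simp_all algebra+
    then show "u (j + 2) * p j = c j + u j" "u j * p (j + 1) = c j + u (j + 2)"
      using nz by simp_all
  qed
  have u3: "u (j + 3) * c j = e j + p j" "u j * c (j + 1) = e j + p (j + 2)" for j
  proof -
    have "p (j + 1) * (u (j + 3) * c j) = p (j + 1) * (e j + p j)"
      "p (j + 1) * (u j * c (j + 1)) = p (j + 1) * (e j + p (j + 2))"
      using u2(1)[of "j + 1"] u2(2)[of j] c[of j] p[of j] p[of "j + 1"]
      by (simp_all add: eval_nat_numeral) algebra+
    then show "u (j + 3) * c j = e j + p j" "u j * c (j + 1) = e j + p (j + 2)"
      using nz by simp_all
  qed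
  have u4: "u (j + 4) * e j = c j + c (j + 1) * w j"
    "u j * e (j + 1) = c (j + 2) + c (j + 1) * w j" for j
  proof -
    have "c (j + 1) * (u (j + 4) * e j) = c (j + 1) * (c j + c (j + 1) * w j)"
      "c (j + 1) * (u j * e (j + 1)) = c (j + 1) * (c (j + 2) + c (j + 1) * w j)"
      using u3(1)[of "j + 1"] u3(2)[of j] e[of j] c[of j] c[of "j + 1"]
      by (simp_all add: eval_nat_numeral) algebra+
    then show "u (j + 4) * e j = c j + c (j + 1) * w j"
      "u j * e (j + 1) = c (j + 2) + c (j + 1) * w j"
      using nz by simp_all
  qed
  have u5: "u (j + 5) * (c (j + 1) * w j) = e j + 1 + p (j + 2) + e (j + 1) * p (j + 2)"
    "u j * (c (j + 2) * w (j + 1)) = e (j + 2) + 1 + p (j + 2) + e (j + 1) * p (j + 2)" for j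
  proof -
    have "e (j + 1) * (u (j + 5) * (c (j + 1) * w j)) =
        e (j + 1) * (e j + 1 + p (j + 2) + e (j + 1) * p (j + 2))"
      using u4(1)[of "j + 1"] w[of j] c[of "j + 1"] e[of j]
      by (simp add: eval_nat_numeral) algebra
    moreover have "e (j + 1) * (u j * (c (j + 2) * w (j + 1))) =
        e (j + 1) * (e (j + 2) + 1 + p (j + 2) + e (j + 1) * p (j + 2))"
      using u4(2)[of j] w[of j] c[of "j + 1"] e[of "j + 1"]
      by (simp add: eval_nat_numeral) algebra
    ultimately show "u (j + 5) * (c (j + 1) * w j) = e j + 1 + p (j + 2) + e (j + 1) * p (j + 2)"
      "u j * (c (j + 2) * w (j + 1)) = e (j + 2) + 1 + p (j + 2) + e (j + 1) * p (j + 2)"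
      using nz(4) by (metis mult_left_cancel)+
  qed
  have u6: "u (j + 6) * (p (j + 2) * c (j + 1) ^ 2) = e j * (c (j + 1) + u (j + 3)) +
      p (j + 2) * c (j + 1) + (2 * p (j + 2) + e (j + 1) * p (j + 2) ^ 2) * u (j + 3)" for j
  proof -
    have "(e (j + 1) * c (j + 2) * w (j + 1)) * (u (j + 6) * (p (j + 2) * c (j + 1) ^ 2)) =
        (e (j + 1) * c (j + 2) * w (j + 1)) * (e j * (c (j + 1) + u (j + 3)) +
          p (j + 2) * c (j + 1) + (2 * p (j + 2) + e (j + 1) * p (j + 2) ^ 2) * u (j + 3))"
      using u5(1)[of "j + 1"] p[of "j + 2"] e[of j] e[of "j + 1"] w[of j] c[of "j + 1"]
      by (simp add: eval_nat_numeral) algebra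
    then show ?thesis
      using nz by simp
  qed
  \<comment> \<open>The time reversal of \<open>u6\<close>.\<close>
  have u6': "u j * (p (j + 3) * c (j + 3) ^ 2) = e (j + 3) * (c (j + 3) + u (j + 3)) +
      p (j + 3) * c (j + 3) + (2 * p (j + 3) + e (j + 2) * p (j + 3) ^ 2) * u (j + 3)" for j
  proof -
    have "(e (j + 2) * c (j + 2) * w (j + 1)) * (u j * (p (j + 3) * c (j + 3) ^ 2)) =
        (e (j + 2) * c (j + 2) * w (j + 1)) * (e (j + 3) * (c (j + 3) + u (j + 3)) +
          p (j + 3) * c (j + 3) + (2 * p (j + 3) + e (j + 2) * p (j + 3) ^ 2) * u (j + 3))"
      using u5(2)[of j] p[of "j + 2"] e[of "j + 1"] e[of "j + 2"] w[of "j + 1"] c[of "j + 2"]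
      by (simp add: eval_nat_numeral) algebra
    then show ?thesis
      using nz by simp
  qed
  \<comment> \<open>\<open>1\<close> and \<open>2\<close> are time reversals of each other. The
    bracket of \<open>1\<close> at \<open>j + 2\<close> equals that of \<open>2\<close> at
    \<open>j\<close>, which will give \<open>J\<close> the period 2.\<close>
  have 1: "(u (j + 6) + u j) * c (j + 1) ^ 2 =
     u (j + 3) * (p (j + 1) * e j + p (j + 1) * p (j + 2) + 1 + e (j + 1) * p (j + 2))" for j
  proof -
    have "p (j + 2) * ((u (j + 6) + u j) * c (j + 1) ^ 2) =
     p (j + 2) * (u (j + 3) * (p (j + 1) * e j + p (j + 1) * p (j + 2) + 1 + e (j + 1) * p (j + 2)))"
      using u6[of j] u3(2)[of j] u[of "j + 2"] p[of "j + 1"] 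
      by (simp add: eval_nat_numeral) algebra
    then show ?thesis
      using nz by simp
  qed
  have 2: "(u (j + 6) + u j) * c (j + 3) ^ 2 =
     u (j + 3) * (p (j + 4) * e (j + 3) + p (j + 3) * p (j + 4) + 1 + e (j + 2) * p (j + 3))" for j
  proof -
    have "p (j + 3) * ((u (j + 6) + u j) * c (j + 3) ^ 2) =
     p (j + 3) * (u (j + 3) * (p (j + 4) * e (j + 3) + p (j + 3) * p (j + 4) + 1 + e (j + 2) * p (j + 3)))"
      using u6'[of j] u3(1)[of "j + 3"] u[of "j + 3"] p[of "j + 3"] 
      by (simp add: eval_nat_numeral) algebra
    then show ?thesis
      using nz by simp
  qed
  define J where "J j = (u (j + 6) + u j) / u (j + 3)" for j
  have J: "J j \<in> F" for j
    unfolding J_def by (intro divide_closed add_closed F)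
  have J1: "u (j + 6) + u j = J j * u (j + 3)" for j
    using nz by (simp add: J_def)
  have period: "J (j + 2) = J j" for j
  proof -
    have "u (j + 3) * u (j + 5) * c (j + 3) ^ 2 * J (j + 2) = u (j + 3) * u (j + 5) * c (j + 3) ^ 2 * J j"
      using 1[of "j + 2"] 2[of j] J1[of j] J1[of "j + 2"] by (simp add: eval_nat_numeral) algebra
    then show ?thesis
      using nz by simp
  qed
  show u_rec: "satisfies_linear_recurrence F u"
    by (rule linear_recurrence_periodic_coefficients[of 2 3 6 "\<lambda>_. J" "\<lambda>_::unit. u" "\<lambda>_. ()" "\<lambda>_. ()"])
      (use J period J1 in \<open>auto simp: eq_diff_eq\<close>)
  \<comment> \<open>Continuants stop at \<open>e\<close>, since \<open>u4\<close> yields only the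
    product \<open>c (j + 1) * w j\<close>. Instead, \<open>w j\<close> is
    \<open>u j * u (j + 4)\<close> up to a correction of period 2.\<close>
  define G where "G j = w j - u j * u (j + 4)" for j
  have "G (j + 2) = G j" for j
  proof -
    have "(c (j + 2) * w (j + 1) * u (j + 3)) * G (j + 2) = (c (j + 2) * w (j + 1) * u (j + 3)) * G j"
      using u5(2)[of j] u5(1)[of "j + 1"] u[of "j + 2"] u[of "j + 3"] w[of j] w[of "j + 1"] p[of "j + 2"]
      unfolding G_def by (simp add: eval_nat_numeral) algebra
    then show ?thesis
      using nz by simp
  qed
  then have "satisfies_linear_recurrence F G"
    by (intro linear_recurrence_periodic[of 2]) auto
  then have "satisfies_linear_recurrence F (\<lambda>j. G j + u j * u (j + 4))"
    using u_rec by (intro linear_recurrence_add linear_recurrence_mult linear_recurrence_shift)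
  then show "satisfies_linear_recurrence F w"
    by (simp add: G_def)
  show p_rec: "satisfies_linear_recurrence F p"
    by (rule linear_recurrence_continuant[of u u "\<lambda>_. 1" 1])
      (use u u_rec linear_recurrence_const in \<open>simp_all add: add.commute\<close>)
  show c_rec: "satisfies_linear_recurrence F c"
    using u_rec p_rec u_rec u2(1) by (rule linear_recurrence_continuant)
  show "satisfies_linear_recurrence F e"
    using u_rec c_rec p_rec u3(1) by (rule linear_recurrence_continuant)
qed

end


section \<open>The field of rational functions\<close>

lemma vars_diff: "vars (p - q) \<subseteq> vars p \<union> vars q"
proof -
  have "Poly_Mapping.keys (p - q) \<subseteq> Poly_Mapping.keys p \<union> Poly_Mapping.keys q"
    by (auto simp only: in_keys_iff lookup_minus Un_iff)
  then show ?thesis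
    unfolding vars_def by blast
qed

lemma subfield_rat_funs: "subfield (rat_funs N)"
proof
  show "1 \<in> rat_funs N"
    by (intro subtraction_free_rat_funs subtraction_free_one)
  have "vars 0 = {}" "vars 1 = {}"
    by (simp_all add: vars_def)
  then show "0 \<in> rat_funs N"
    unfolding rat_funs_def Zero_fract_def
    by (intro CollectI exI[of _ "0 :: rat_mpoly"] exI[of _ "1 :: rat_mpoly"]) simp
next
  fix x y assume "x \<in> rat_funs N" "y \<in> rat_funs N"
  then obtain p q p' q' where *: "x = Fract p q" "y = Fract p' q'" "q \<noteq> 0" "q' \<noteq> 0"
    "vars p \<subseteq> {1..N}" "vars q \<subseteq> {1..N}" "vars p' \<subseteq> {1..N}" "vars q' \<subseteq> {1..N}"
    by (auto simp: rat_funs_def)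
  have "x - y = Fract (p * q' - p' * q) (q * q')" "x * y = Fract (p * p') (q * q')" "q * q' \<noteq> 0"
    using * by simp_all
  moreover have "vars (p * q' - p' * q) \<subseteq> {1..N}" "vars (p * p') \<subseteq> {1..N}" "vars (q * q') \<subseteq> {1..N}"
    using * vars_mult vars_diff by (meson Un_least order_trans)+
  ultimately show "x - y \<in> rat_funs N" "x * y \<in> rat_funs N"
    unfolding rat_funs_def by blast+
next
  fix x assume "x \<in> rat_funs N"
  then obtain p q where *: "x = Fract p q" "q \<noteq> 0" "vars p \<subseteq> {1..N}" "vars q \<subseteq> {1..N}"
    by (auto simp: rat_funs_def)
  show "inverse x \<in> rat_funs N"
  proof (cases "p = 0")
    \<comment> \<open>Here \<open>x\<close> is 0, whose inverse is 0 by convention.\<close>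
    case True
    with * have "inverse x = x"
      by (simp add: fract_collapse)
    then show ?thesis
      using \<open>x \<in> rat_funs N\<close> by simp
  next
    case False
    with * have "inverse x = Fract q p"
      by simp
    with False * show ?thesis
      unfolding rat_funs_def by blast
  qed
qed


section \<open>Quivers whose underlying graph is a chain\<close>

text \<open>All six types have this form, so orientation and numbering can be dealt with
  once.\<close>

definition chain :: "nat \<Rightarrow> (nat \<Rightarrow> nat) \<Rightarrow> (nat \<Rightarrow> nat) \<Rightarrow> vgraph" where
  "chain n a b = (n, (\<lambda>i. (i, Suc i, a i, b i)) ` {1..<n})"

lemma sym_edges_iff: "(i, k, x, y) \<in> sym_edges D \<longleftrightarrow> (i, k, x, y) \<in> D \<or> (k, i, y, x) \<in> D"
proof -
  have "(i, k, x, y) \<in> (\<lambda>(i, k, a, b). (k, i, b, a)) ` D" if "(k, i, y, x) \<in> D"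
    using imageI[OF that, of "\<lambda>(i, k, a, b). (k, i, b, a)"] by simp
  then show ?thesis
    unfolding sym_edges_def by auto
qed

lemma sym_edges_chain:
  "(i, k, x, y) \<in> sym_edges (snd (chain n a b)) \<longleftrightarrow>
     (i \<in> {1..<n} \<and> k = Suc i \<and> x = a i \<and> y = b i) \<or>
     (k \<in> {1..<n} \<and> i = Suc k \<and> x = b k \<and> y = a k)"
  unfolding sym_edges_iff chain_def by auto

lemma sym_edges_edges:
  "(i, k, x, y) \<in> sym_edges (edges Q) \<longleftrightarrow>
     ((i, k) \<in> arrows Q \<or> (k, i) \<in> arrows Q) \<and> x = val Q i k \<and> y = val Q k i"
  unfolding sym_edges_iff edges_def by auto

text \<open>
  Reversing the arrow \<open>i \<rightarrow> i + 1\<close> of a chain amounts to delaying the sequences of all later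
  vertices by one step, so the orientation may be assumed to be linear.
\<close>

lemma frieze_sequences_chain:
  assumes Q: "valued_quiver Q" "has_type Q (chain n a b)" and X: "frieze_sequences Q X"
  obtains \<sigma> h where "bij_betw \<sigma> {1..n} {1..nverts Q}"
    "\<And>i j. i \<in> {1..n} \<Longrightarrow> X (\<sigma> i) (Suc j + h i) * X (\<sigma> i) (j + h i) =
       1 + (if i = 1 then 1 else X (\<sigma> (i - 1)) (Suc j + h (i - 1)) ^ b (i - 1)) *
           (if i = n then 1 else X (\<sigma> (Suc i)) (j + h (Suc i)) ^ a i)"
proof -
  obtain \<sigma> where "bij_betw \<sigma> {1..fst (chain n a b)} {1..nverts Q}"
    and eq: "sym_edges (edges Q) = (\<lambda>(i, k, a, b). (\<sigma> i, \<sigma> k, a, b)) ` sym_edges (snd (chain n a b))"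
    using Q(2) unfolding has_type_def by blast
  then have \<sigma>: "bij_betw \<sigma> {1..n} {1..nverts Q}"
    by (simp add: chain_def)
  have inj: "\<sigma> i = \<sigma> k \<longleftrightarrow> i = k" if "i \<in> {1..n}" "k \<in> {1..n}" for i k
    using inj_on_eq_iff[OF bij_betw_imp_inj_on[OF \<sigma>] that] .
  define r where "r i \<longleftrightarrow> (\<sigma> i, \<sigma> (Suc i)) \<in> arrows Q" for i
  have asym: "(k, i) \<notin> arrows Q" if "(i, k) \<in> arrows Q" for i k
  proof
    assume "(k, i) \<in> arrows Q"
    with that have "(i, i) \<in> (arrows Q)\<^sup>+"
      by (rule trancl.trancl_into_trancl[OF trancl.r_into_trancl])
    with Q(1) show False
      by (simp add: valued_quiver_def acyclic_def)
  qed
  have edge: "(\<sigma> (Suc i), \<sigma> i) \<in> arrows Q \<longleftrightarrow> \<not> r i"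
    "val Q (\<sigma> i) (\<sigma> (Suc i)) = a i" "val Q (\<sigma> (Suc i)) (\<sigma> i) = b i"
    if "i \<in> {1..<n}" for i
  proof -
    have "(\<sigma> i, \<sigma> (Suc i), a i, b i) \<in> sym_edges (edges Q)"
      unfolding eq using that
      by (intro image_eqI[of _ _ "(i, Suc i, a i, b i)"]) (auto simp: sym_edges_chain)
    then have *: "r i \<or> (\<sigma> (Suc i), \<sigma> i) \<in> arrows Q"
      "a i = val Q (\<sigma> i) (\<sigma> (Suc i))" "b i = val Q (\<sigma> (Suc i)) (\<sigma> i)"
      unfolding sym_edges_edges r_def by blast+
    then show "(\<sigma> (Suc i), \<sigma> i) \<in> arrows Q \<longleftrightarrow> \<not> r i"
      "val Q (\<sigma> i) (\<sigma> (Suc i)) = a i" "val Q (\<sigma> (Suc i)) (\<sigma> i) = b i"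
      using asym[of "\<sigma> i" "\<sigma> (Suc i)"] by (auto simp only: r_def)
  qed
  have arrowE: "\<exists>i\<in>{1..<n}. (s = \<sigma> i \<and> t = \<sigma> (Suc i)) \<or> (s = \<sigma> (Suc i) \<and> t = \<sigma> i)"
    if "(s, t) \<in> arrows Q" for s t
  proof -
    have "(s, t, val Q s t, val Q t s) \<in> sym_edges (edges Q)"
      using that by (simp add: sym_edges_edges)
    then show ?thesis
      unfolding eq by (force simp: sym_edges_chain)
  qed
  have pred: "{s. (s, \<sigma> i) \<in> arrows Q} =
      (if i \<noteq> 1 \<and> r (i - 1) then {\<sigma> (i - 1)} else {}) \<union> (if i \<noteq> n \<and> \<not> r i then {\<sigma> (Suc i)} else {})"
    (is "?L = ?R") if i: "i \<in> {1..n}" for i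
  proof (intro equalityI subsetI)
    fix s assume "s \<in> ?L"
    then have s: "(s, \<sigma> i) \<in> arrows Q"
      by simp
    then obtain k where "k \<in> {1..<n}" "(s = \<sigma> k \<and> \<sigma> i = \<sigma> (Suc k)) \<or> (s = \<sigma> (Suc k) \<and> \<sigma> i = \<sigma> k)"
      using arrowE by blast
    then show "s \<in> ?R"
      using s i edge(1)[of k] inj[of i k] inj[of i "Suc k"] by (auto simp: r_def)
  next
    fix s assume "s \<in> ?R"
    then show "s \<in> ?L"
      using i edge(1)[of i] by (auto simp: r_def split: if_splits)
  qed
  have succ: "{d. (\<sigma> i, d) \<in> arrows Q} =
      (if i \<noteq> 1 \<and> \<not> r (i - 1) then {\<sigma> (i - 1)} else {}) \<union> (if i \<noteq> n \<and> r i then {\<sigma> (Suc i)} else {})"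
    (is "?L = ?R") if i: "i \<in> {1..n}" for i
  proof (intro equalityI subsetI)
    fix s assume "s \<in> ?L"
    then have s: "(\<sigma> i, s) \<in> arrows Q"
      by simp
    then obtain k where "k \<in> {1..<n}" "(\<sigma> i = \<sigma> k \<and> s = \<sigma> (Suc k)) \<or> (\<sigma> i = \<sigma> (Suc k) \<and> s = \<sigma> k)"
      using arrowE by blast
    then show "s \<in> ?R"
      using s i edge(1)[of k] inj[of i k] inj[of i "Suc k"] by (auto simp: r_def)
  next
    fix s assume "s \<in> ?R"
    moreover have "i - 1 \<in> {1..<n}" if "i \<noteq> 1"
      using i that by auto
    ultimately show "s \<in> ?L"
      using i edge(1)[of "i - 1"] by (auto simp: r_def split: if_splits)
  qed
  \<comment> \<open>Distinct neighbours are needed to split a product over two of them into its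
    factors.\<close>
  have neq: "\<sigma> (i - 1) \<noteq> \<sigma> (Suc i)" if "i \<in> {1..n}" "i \<noteq> 1" "i \<noteq> n" for i
  proof -
    have "i - 1 \<in> {1..n}" "Suc i \<in> {1..n}"
      using that by auto
    from inj[OF this] show ?thesis
      by simp
  qed
  \<comment> \<open>The number of backward arrows before \<open>i\<close>, which is the total delay.
    At a backward arrow \<open>j + h (Suc i)\<close> equals \<open>Suc j + h i\<close>, so a
    successor term takes the form of a predecessor term and conversely.\<close>
  define h where "h i = (\<Sum>k\<in>{1..<i}. if r k then 0 else 1 :: nat)" for i
  have h_Suc: "h (Suc i) = h i + (if r i then 0 else 1)" if "i \<ge> 1" for i
    using that by (simp add: h_def)
  have "X (\<sigma> i) (Suc j + h i) * X (\<sigma> i) (j + h i) =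
       1 + (if i = 1 then 1 else X (\<sigma> (i - 1)) (Suc j + h (i - 1)) ^ b (i - 1)) *
           (if i = n then 1 else X (\<sigma> (Suc i)) (j + h (Suc i)) ^ a i)"
    if i: "i \<in> {1..n}" for i j
  proof -
    have "\<sigma> i \<in> {1..nverts Q}"
      using \<sigma> i by (auto simp: bij_betw_def)
    then have "X (\<sigma> i) (Suc j + h i) * X (\<sigma> i) (j + h i) =
        1 + (\<Prod>s | (s, \<sigma> i) \<in> arrows Q. X s (Suc (j + h i)) ^ val Q (\<sigma> i) s) *
            (\<Prod>d | (\<sigma> i, d) \<in> arrows Q. X d (j + h i) ^ val Q (\<sigma> i) d)"
      using X by (simp add: frieze_sequences_def)
    moreover have "h i = h (i - 1) + (if r (i - 1) then 0 else 1)" "val Q (\<sigma> i) (\<sigma> (i - 1)) = b (i - 1)"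
      if "i \<noteq> 1"
    proof -
      have "i - 1 \<in> {1..<n}" "Suc (i - 1) = i"
        using i that by auto
      with h_Suc[of "i - 1"] edge(3)[of "i - 1"]
      show "h i = h (i - 1) + (if r (i - 1) then 0 else 1)" "val Q (\<sigma> i) (\<sigma> (i - 1)) = b (i - 1)"
        by simp_all
    qed
    moreover have "h (Suc i) = h i + (if r i then 0 else 1)" "val Q (\<sigma> i) (\<sigma> (Suc i)) = a i"
      if "i \<noteq> n"
      using h_Suc[of i] edge(2)[of i] i that by auto
    ultimately show ?thesis
      unfolding pred[OF i] succ[OF i] using neq[OF i]
      by (cases "i = 1"; cases "i = n"; cases "r (i - 1)"; cases "r i") (simp_all add: mult.commute)
  qed
  with \<sigma> show thesis
    by (rule that)
qed

section \<open>The six types, each matched with one of the systems of relations above\<close>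

theorem theorem9p1:
  fixes Q :: vquiver and T :: vgraph and X :: "nat \<Rightarrow> nat \<Rightarrow> rat_fun"
  assumes "valued_quiver Q"
    and "T \<in> {G21, G22, F41, F42, A11, A12}"
    and "has_type Q T"
    and "frieze_sequences Q X"
  shows "\<forall>i\<in>{1..nverts Q}. satisfies_linear_recurrence (rat_funs (nverts Q)) (X i)"
proof -
  let ?F = "rat_funs (nverts Q)"
  interpret subfield ?F
    by (rule subfield_rat_funs)
  \<comment> \<open>Reduces a type to the linearly oriented chain: \<open>z\<close> consists of the
    delayed sequences, and the delays are removed at the end.\<close>
  have from_chain: "\<forall>i\<in>{1..nverts Q}. satisfies_linear_recurrence ?F (X i)"
    if T: "T = chain n a b"
      and rec: "\<And>z :: nat \<Rightarrow> nat \<Rightarrow> rat_fun. (\<And>i j. i \<in> {1..n} \<Longrightarrow> z i j \<in> ?F) \<Longrightarrow>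
        (\<And>i j. i \<in> {1..n} \<Longrightarrow> z i j \<noteq> 0) \<Longrightarrow>
        (\<And>i j. i \<in> {1..n} \<Longrightarrow> z i (Suc j) * z i j =
          1 + (if i = 1 then 1 else z (i - 1) (Suc j) ^ b (i - 1)) *
              (if i = n then 1 else z (Suc i) j ^ a i)) \<Longrightarrow>
        \<forall>i\<in>{1..n}. satisfies_linear_recurrence ?F (z i)"
    for n a b
  proof
    obtain \<sigma> h where \<sigma>: "bij_betw \<sigma> {1..n} {1..nverts Q}"
      and eq: "\<And>i j. i \<in> {1..n} \<Longrightarrow> X (\<sigma> i) (Suc j + h i) * X (\<sigma> i) (j + h i) =
       1 + (if i = 1 then 1 else X (\<sigma> (i - 1)) (Suc j + h (i - 1)) ^ b (i - 1)) *
           (if i = n then 1 else X (\<sigma> (Suc i)) (j + h (Suc i)) ^ a i)"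
      using frieze_sequences_chain assms(1,3,4) unfolding T by blast
    have X: "X (\<sigma> i) j \<in> ?F" "X (\<sigma> i) j \<noteq> 0" if "i \<in> {1..n}" for i j
    proof -
      have "\<sigma> i \<in> {1..nverts Q}"
        using \<sigma> that by (auto simp: bij_betw_def)
      then have "subtraction_free (nverts Q) (X (\<sigma> i) j)"
        using frieze_sequences_unique[OF assms(1,4)] subtraction_free_frieze[OF assms(1)] by simp
      then show "X (\<sigma> i) j \<in> ?F" "X (\<sigma> i) j \<noteq> 0"
        by (rule subtraction_free_rat_funs, rule subtraction_free_nonzero)
    qed
    have z: "\<forall>i\<in>{1..n}. satisfies_linear_recurrence ?F (\<lambda>j. X (\<sigma> i) (j + h i))"
      by (rule rec) (use X eq in simp_all)
    fix i assume "i \<in> {1..nverts Q}"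
    then have "i \<in> \<sigma> ` {1..n}"
      using bij_betw_imp_surj_on[OF \<sigma>] by simp
    then obtain k where "k \<in> {1..n}" "i = \<sigma> k"
      by blast
    with z show "satisfies_linear_recurrence ?F (X i)"
      using linear_recurrence_unshift by blast
  qed
  have Icc: "{1..2} = {1, 2 :: nat}" "{1..3} = {1, 2, 3 :: nat}" "{1..5} = {1, 2, 3, 4, 5 :: nat}"
    "{1..<2} = {1 :: nat}" "{1..<3} = {1, 2 :: nat}" "{1..<5} = {1, 2, 3, 4 :: nat}"
    by auto
  consider "T = A11" | "T = A12" | "T = G21" | "T = G22" | "T = F41" | "T = F42"
    using assms(2) by blast
  then show ?thesis
  proof cases
    case 1
    then have "T = chain 2 (\<lambda>_. 1) (\<lambda>_. 4)"
      unfolding A11_def chain_def Icc by (simp add: eval_nat_numeral)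
    then show ?thesis
    proof (rule from_chain)
      fix z :: "nat \<Rightarrow> nat \<Rightarrow> rat_fun"
      assume z: "\<And>i j. i \<in> {1..2} \<Longrightarrow> z i j \<in> ?F" "\<And>i j. i \<in> {1..2} \<Longrightarrow> z i j \<noteq> 0"
        and eq: "\<And>i j. i \<in> {1..2} \<Longrightarrow> z i (Suc j) * z i j =
          1 + (if i = 1 then 1 else z (i - 1) (Suc j) ^ 4) *
              (if i = 2 then 1 else z (Suc i) j ^ 1)"
      \<comment> \<open>The exponent 4 is split as 1 + 3 to identify all four leaves.\<close>
      have "z 1 (Suc j) * z 1 j = 1 + z 2 j" "z 2 (Suc j) * z 2 j = 1 + z 1 (Suc j) * z 1 (Suc j) ^ 3"
        for j
        using eq[of 1 j] eq[of 2 j] by (simp_all add: eval_nat_numeral)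
      from linear_recurrence_D4[of "z 1" "z 1" "z 2", OF _ _ _ _ _ this(1,1,2)] z
      show "\<forall>i\<in>{1..2}. satisfies_linear_recurrence ?F (z i)"
        unfolding Icc by simp
    qed
  next
    case 2
    then have "T = chain 2 (\<lambda>_. 2) (\<lambda>_. 2)"
      unfolding A12_def chain_def Icc by (simp add: eval_nat_numeral)
    then show ?thesis
    proof (rule from_chain)
      fix z :: "nat \<Rightarrow> nat \<Rightarrow> rat_fun"
      assume z: "\<And>i j. i \<in> {1..2} \<Longrightarrow> z i j \<in> ?F" "\<And>i j. i \<in> {1..2} \<Longrightarrow> z i j \<noteq> 0"
        and eq: "\<And>i j. i \<in> {1..2} \<Longrightarrow> z i (Suc j) * z i j =
          1 + (if i = 1 then 1 else z (i - 1) (Suc j) ^ 2) *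
              (if i = 2 then 1 else z (Suc i) j ^ 2)"
      have "z 1 (Suc j) * z 1 j = 1 + z 2 j ^ 2" "z 2 (Suc j) * z 2 j = 1 + z 1 (Suc j) ^ 2" for j
        using eq[of 1 j] eq[of 2 j] by (simp_all add: eval_nat_numeral)
      from linear_recurrence_A12[of "z 1" "z 2", OF _ _ _ _ this] z
      show "\<forall>i\<in>{1..2}. satisfies_linear_recurrence ?F (z i)"
        unfolding Icc by simp
    qed
  next
    case 3
    then have "T = chain 3 (\<lambda>_. 1) (\<lambda>i. if i = 2 then 3 else 1)"
      unfolding G21_def chain_def Icc by (simp add: eval_nat_numeral)
    then show ?thesis
    proof (rule from_chain)
      fix z :: "nat \<Rightarrow> nat \<Rightarrow> rat_fun"
      assume z: "\<And>i j. i \<in> {1..3} \<Longrightarrow> z i j \<in> ?F" "\<And>i j. i \<in> {1..3} \<Longrightarrow> z i j \<noteq> 0"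
        and eq: "\<And>i j. i \<in> {1..3} \<Longrightarrow> z i (Suc j) * z i j =
          1 + (if i = 1 then 1 else z (i - 1) (Suc j) ^ (if i - 1 = 2 then 3 else 1)) *
              (if i = 3 then 1 else z (Suc i) j ^ 1)"
      \<comment> \<open>The exponent 3 is split as 1 + 2 to identify all three arms.\<close>
      have "z 1 (Suc j) * z 1 j = 1 + z 2 j" "z 2 (Suc j) * z 2 j = 1 + z 1 (Suc j) * z 3 j"
        "z 3 (Suc j) * z 3 j = 1 + z 2 (Suc j) * z 2 (Suc j) ^ 2" for j
        using eq[of 1 j] eq[of 2 j] eq[of 3 j] by (simp_all add: eval_nat_numeral)
      from linear_recurrence_E6[of "z 1" "z 1" "z 2" "z 2" "z 3", OF _ _ _ _ _ _ _ this(1,1,2,2,3)] z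
      show "\<forall>i\<in>{1..3}. satisfies_linear_recurrence ?F (z i)"
        unfolding Icc by simp
    qed
  next
    case 4
    then have "T = chain 3 (\<lambda>i. if i = 2 then 3 else 1) (\<lambda>_. 1)"
      unfolding G22_def chain_def Icc by (simp add: eval_nat_numeral)
    then show ?thesis
    proof (rule from_chain)
      fix z :: "nat \<Rightarrow> nat \<Rightarrow> rat_fun"
      assume z: "\<And>i j. i \<in> {1..3} \<Longrightarrow> z i j \<in> ?F" "\<And>i j. i \<in> {1..3} \<Longrightarrow> z i j \<noteq> 0"
        and eq: "\<And>i j. i \<in> {1..3} \<Longrightarrow> z i (Suc j) * z i j =
          1 + (if i = 1 then 1 else z (i - 1) (Suc j) ^ 1) *
              (if i = 3 then 1 else z (Suc i) j ^ (if i = 2 then 3 else 1))"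
      \<comment> \<open>Vertex 3 comes after the centre 2; delaying \<open>z 1\<close> and
        \<open>z 2\<close> by one makes both leaves precede the centre, as
        \<open>linear_recurrence_D4\<close> requires.\<close>
      have "z 1 (Suc j + 1) * z 1 (j + 1) = 1 + z 2 (j + 1)" "z 3 (Suc j) * z 3 j = 1 + z 2 (j + 1)"
        "z 2 (Suc j + 1) * z 2 (j + 1) = 1 + z 1 (Suc j + 1) * z 3 (Suc j) ^ 3" for j
        using eq[of 1 "Suc j"] eq[of 2 "Suc j"] eq[of 3 j] by (simp_all add: eval_nat_numeral)
      from linear_recurrence_D4[of "\<lambda>j. z 1 (j + 1)" "z 3" "\<lambda>j. z 2 (j + 1)", OF _ _ _ _ _ this] z
      show "\<forall>i\<in>{1..3}. satisfies_linear_recurrence ?F (z i)"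
        unfolding Icc using linear_recurrence_unshift[of "z _" 1] by simp
    qed
  next
    case 5
    then have "T = chain 5 (\<lambda>_. 1) (\<lambda>i. if i = 3 then 2 else 1)"
      unfolding F41_def chain_def Icc by (simp add: eval_nat_numeral)
    then show ?thesis
    proof (rule from_chain)
      fix z :: "nat \<Rightarrow> nat \<Rightarrow> rat_fun"
      assume z: "\<And>i j. i \<in> {1..5} \<Longrightarrow> z i j \<in> ?F" "\<And>i j. i \<in> {1..5} \<Longrightarrow> z i j \<noteq> 0"
        and eq: "\<And>i j. i \<in> {1..5} \<Longrightarrow> z i (Suc j) * z i j =
          1 + (if i = 1 then 1 else z (i - 1) (Suc j) ^ (if i - 1 = 3 then 2 else 1)) *
              (if i = 5 then 1 else z (Suc i) j ^ 1)"
      \<comment> \<open>Vertex 4 is the centre and vertex 5 the short arm; the orientation already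
        agrees with \<open>linear_recurrence_E7\<close>.\<close>
      have "z 1 (Suc j) * z 1 j = 1 + z 2 j" "z 2 (Suc j) * z 2 j = 1 + z 1 (Suc j) * z 3 j"
        "z 3 (Suc j) * z 3 j = 1 + z 2 (Suc j) * z 4 j"
        "z 4 (Suc j) * z 4 j = 1 + z 3 (Suc j) ^ 2 * z 5 j"
        "z 5 (Suc j) * z 5 j = 1 + z 4 (Suc j)" for j
        using eq[of 1 j] eq[of 2 j] eq[of 3 j] eq[of 4 j] eq[of 5 j] by (simp_all add: eval_nat_numeral)
      from linear_recurrence_E7[of "z 1" "z 5" "z 2" "z 3" "z 4", OF _ _ _ _ _ _ _ this] z
      show "\<forall>i\<in>{1..5}. satisfies_linear_recurrence ?F (z i)"
        unfolding Icc by simp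
    qed
  next
    case 6
    then have "T = chain 5 (\<lambda>i. if i = 3 then 2 else 1) (\<lambda>_. 1)"
      unfolding F42_def chain_def Icc by (simp add: eval_nat_numeral)
    then show ?thesis
    proof (rule from_chain)
      fix z :: "nat \<Rightarrow> nat \<Rightarrow> rat_fun"
      assume z: "\<And>i j. i \<in> {1..5} \<Longrightarrow> z i j \<in> ?F" "\<And>i j. i \<in> {1..5} \<Longrightarrow> z i j \<noteq> 0"
        and eq: "\<And>i j. i \<in> {1..5} \<Longrightarrow> z i (Suc j) * z i j =
          1 + (if i = 1 then 1 else z (i - 1) (Suc j) ^ 1) *
              (if i = 5 then 1 else z (Suc i) j ^ (if i = 3 then 2 else 1))"
      \<comment> \<open>Vertex 3 is the centre; the delays 2, 2, 2, 1, 0 turn the arm through 4 and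
        5 towards it.\<close>
      have "z 1 (Suc j + 2) * z 1 (j + 2) = 1 + z 2 (j + 2)" "z 5 (Suc j) * z 5 j = 1 + z 4 (j + 1)"
        "z 2 (Suc j + 2) * z 2 (j + 2) = 1 + z 1 (Suc j + 2) * z 3 (j + 2)"
        "z 4 (Suc j + 1) * z 4 (j + 1) = 1 + z 5 (Suc j) * z 3 (j + 2)"
        "z 3 (Suc j + 2) * z 3 (j + 2) = 1 + z 2 (Suc j + 2) * z 4 (Suc j + 1) ^ 2" for j
        using eq[of 1 "j + 2"] eq[of 2 "j + 2"] eq[of 3 "j + 2"] eq[of 4 "j + 1"] eq[of 5 j]
        by (simp_all add: eval_nat_numeral mult.commute)
      from linear_recurrence_E6[of "\<lambda>j. z 1 (j + 2)" "z 5" "\<lambda>j. z 2 (j + 2)" "\<lambda>j. z 4 (j + 1)"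
          "\<lambda>j. z 3 (j + 2)", OF _ _ _ _ _ _ _ this] z
      show "\<forall>i\<in>{1..5}. satisfies_linear_recurrence ?F (z i)"
        unfolding Icc using linear_recurrence_unshift[of "z _" 1] linear_recurrence_unshift[of "z _" 2]
        by simp
    qed
  qed
qed

end
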